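(* The Cantor–Bendixson rank of $\overline{\mathcal{X}}$, the closure of $\mathcal{X}$ in $\mathcal{M}_8$, is $1$.
   Context: The Cantor–Bendixson rank of a topological space is the least ordinal at which the (iterated) removal of isolated points makes no change to the space. $\mathcal{M}_k$ is the space of marked groups: pairs $(G,S)$ with $S$ an ordered set of $k$ generators of $G$, with metric $d((G_1,S_1),(G_2,S_2))=2^{-n}$ where $n$ is the largest integer such that the balls of radius $n$ about the identity of the (labelled) Cayley graphs are identical; two marked groups are the same point iff the order-preserving bijection of generators extends to an isomorphism. $\Omega=\{0,1,2\}^{\mathbb{N}}$, with elements $\omega=\omega_1\omega_2\cdots$. Let $T_2$ be the rooted binary tree whose vertices are the finite words over $\{0,1\}$. Let $a\in \mathrm{Aut}(T_2)$ swap the two subtrees at the root ($0w\leftrightarrow 1w$). A sequence $(p_n)_{n\ge1}$ with $p_n\in\{P,I\}$ is identified with the automorphism that acts at each vertex $1^{n-1}0$ by swapping the two subtrees below it if $p_n=P$ and trivially if $p_n=I$, and acts trivially at all other vertices. Let $x=(P,P,P,\dots)$, and let $b_\omega,c_\omega,d_\omega$ be the automorphisms given by the sequences with $b_n=P$ iff $\omega_n\in\{0,1\}$, $c_n=P$ iff $\omega_n\in\{0,2\}$, $d_n=P$ iff $\omega_n\in\{1,2\}$. Put $\tilde b_\omega=xb_\omega$, $\tilde c_\omega=xc_\omega$, $\tilde d_\omega=xd_\omega$. $\tilde G_\omega$ is the group generated by $\tilde S_\omega=(a,b_\omega,c_\omega,d_\omega,x,\tilde b_\omega,\tilde c_\omega,\tilde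 d_\omega)$, and $\mathcal{X}=\{(\tilde G_\omega,\tilde S_\omega)\}_{\omega\in\Omega}\subset\mathcal{M}_8$. *)

theory Defs
  imports "HOL-Analysis.Analysis" "HOL-Algebra.Generated_Groups"
begin

section \<open>Cantor--Bendixson rank\<close>

definition remove_isolated :: "'a topology \<Rightarrow> 'a set \<Rightarrow> 'a set" where
  "remove_isolated X A = A - {p \<in> A. openin (subtopology X A) {p}}"

text \<open>An element \<open>\<alpha>\<close> of a well-ordered type stands for the ordinal that is the order type of
  \<open>{..<\<alpha>}\<close>.  The single equation below covers the zero, successor and limit clauses of the usual
  transfinite recursion, because the derivatives form a decreasing sequence; see
  \<open>cb_derivative_least\<close>, \<open>cb_derivative_succ\<close> and \<open>cb_derivative_limit\<close>.\<close>

function cb_derivative :: "'a topology \<Rightarrow> 'o::wellorder \<Rightarrow> 'a set" where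
  "cb_derivative X \<alpha> = topspace X \<inter> (\<Inter>\<beta>\<in>{..<\<alpha>}. remove_isolated X (cb_derivative X \<beta>))"
  by auto
termination
  by (relation "inv_image {(x, y). x < y} snd") (auto intro: wf)

declare cb_derivative.simps [simp del]

definition is_CB_rank :: "'a topology \<Rightarrow> 'o::wellorder \<Rightarrow> bool" where
  "is_CB_rank X \<alpha> \<longleftrightarrow>
     remove_isolated X (cb_derivative X \<alpha>) = cb_derivative X \<alpha> \<and>
     (\<forall>\<beta><\<alpha>. remove_isolated X (cb_derivative X \<beta>) \<noteq> cb_derivative X \<beta>)"

lemma remove_isolated_subset: "remove_isolated X A \<subseteq> A"
  by (auto simp: remove_isolated_def)

lemma cb_derivative_least:
  assumes "\<And>\<beta>. \<not> \<beta> < \<alpha>"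
  shows "cb_derivative X \<alpha> = topspace X"
  using assms cb_derivative.simps[of X \<alpha>] by auto

lemma mem_cb_derivative:
  "p \<in> cb_derivative X \<alpha> \<longleftrightarrow>
     p \<in> topspace X \<and> (\<forall>\<beta><\<alpha>. p \<in> remove_isolated X (cb_derivative X \<beta>))"
  using cb_derivative.simps[of X \<alpha>] by blast

lemma cb_derivative_mono: "\<alpha> \<le> \<beta> \<Longrightarrow> cb_derivative X \<beta> \<subseteq> cb_derivative X \<alpha>"
  unfolding subset_iff mem_cb_derivative[of _ X \<alpha>] mem_cb_derivative[of _ X \<beta>]
  using less_le_trans by blast

lemma cb_derivative_succ:
  assumes "\<alpha> < \<gamma>" "\<And>\<beta>. \<beta> < \<gamma> \<Longrightarrow> \<beta> \<le> \<alpha>"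
  shows "cb_derivative X \<gamma> = remove_isolated X (cb_derivative X \<alpha>)"
proof (intro subset_antisym subsetI)
  fix p assume "p \<in> cb_derivative X \<gamma>"
  then show "p \<in> remove_isolated X (cb_derivative X \<alpha>)"
    using assms(1) mem_cb_derivative[of p X \<gamma>] by blast
next
  fix p assume p: "p \<in> remove_isolated X (cb_derivative X \<alpha>)"
  then have "p \<in> cb_derivative X \<alpha>"
    by (rule subsetD[OF remove_isolated_subset])
  then have "p \<in> topspace X" "\<forall>\<beta><\<alpha>. p \<in> remove_isolated X (cb_derivative X \<beta>)"
    using mem_cb_derivative[of p X \<alpha>] by blast+
  then show "p \<in> cb_derivative X \<gamma>"
    using p assms(2) mem_cb_derivative[of p X \<gamma>] le_less by blast
qed

lemma cb_derivative_limit: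
  assumes "\<alpha> < \<gamma>" "\<And>\<beta>. \<beta> < \<gamma> \<Longrightarrow> \<exists>\<delta>. \<beta> < \<delta> \<and> \<delta> < \<gamma>"
  shows "cb_derivative X \<gamma> = (\<Inter>\<beta>\<in>{..<\<gamma>}. cb_derivative X \<beta>)"
proof (intro subset_antisym subsetI)
  fix p assume "p \<in> cb_derivative X \<gamma>"
  then show "p \<in> (\<Inter>\<beta>\<in>{..<\<gamma>}. cb_derivative X \<beta>)"
    using cb_derivative_mono[OF less_imp_le, of _ \<gamma> X] by blast
next
  fix p assume "p \<in> (\<Inter>\<beta>\<in>{..<\<gamma>}. cb_derivative X \<beta>)"
  then have p: "p \<in> cb_derivative X \<beta>" if "\<beta> < \<gamma>" for \<beta>
    using that by blast
  have "p \<in> remove_isolated X (cb_derivative X \<beta>)" if "\<beta> < \<gamma>" for \<beta>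
    using assms(2)[OF that] p mem_cb_derivative[of p X] by blast
  moreover have "p \<in> topspace X"
    using p[OF assms(1)] mem_cb_derivative[of p X \<alpha>] by blast
  ultimately show "p \<in> cb_derivative X \<gamma>"
    using mem_cb_derivative[of p X \<gamma>] by blast
qed

lemma cb_derivative_nat:
  "cb_derivative X (0::nat) = topspace X"
  "cb_derivative X (Suc n) = remove_isolated X (cb_derivative X n)"
  by (rule cb_derivative_least, simp) (rule cb_derivative_succ, simp_all)


section \<open>Balls in rooted graphs with labelled edges\<close>

text \<open>A triple \<open>(u, i, v)\<close> is a directed edge from \<open>u\<close> to \<open>v\<close> with label \<open>i\<close>; distances ignore
  the direction.\<close>

primrec ball_vertices :: "'v \<Rightarrow> ('v \<times> nat \<times> 'v) set \<Rightarrow> nat \<Rightarrow> 'v set" where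
  "ball_vertices r E 0 = {r}"
| "ball_vertices r E (Suc n) = ball_vertices r E n \<union>
     {v. \<exists>u \<in> ball_vertices r E n. \<exists>i. (u, i, v) \<in> E \<or> (v, i, u) \<in> E}"

text \<open>The edges of the ball of radius \<open>n\<close> are those traversed by some path of length at most
  \<open>n\<close> from the root.  In particular the ball of radius 0 has no edges, so that balls of radius
  0 always agree.\<close>

definition ball_edges :: "'v \<Rightarrow> ('v \<times> nat \<times> 'v) set \<Rightarrow> nat \<Rightarrow> ('v \<times> nat \<times> 'v) set" where
  "ball_edges r E n =
     {(u, i, v) \<in> E. \<exists>m<n. u \<in> ball_vertices r E m \<or> v \<in> ball_vertices r E m}"

definition same_balls ::
  "'v \<Rightarrow> ('v \<times> nat \<times> 'v) set \<Rightarrow> 'w \<Rightarrow> ('w \<times> nat \<times> 'w) set \<Rightarrow> nat \<Rightarrow> bool" where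
  "same_balls r E r' E' n \<longleftrightarrow>
     (\<exists>f. bij_betw f (ball_vertices r E n) (ball_vertices r' E' n) \<and> f r = r' \<and>
          (\<lambda>(u, i, v). (f u, i, f v)) ` ball_edges r E n = ball_edges r' E' n)"


lemma ball_vertices_mono: "m \<le> n \<Longrightarrow> ball_vertices r E m \<subseteq> ball_vertices r E n"
  by (rule lift_Suc_mono_le[of "ball_vertices r E"]) auto

lemma root_in_ball: "r \<in> ball_vertices r E n"
  using ball_vertices_mono[of 0 n r E] by auto

lemma ball_edges_subset: "ball_edges r E n \<subseteq> E"
  by (auto simp: ball_edges_def)

lemma ball_edges_mono:
  assumes "m \<le> n"
  shows "ball_edges r E m \<subseteq> ball_edges r E n"
proof (clarify)
  fix u i v assume "(u, i, v) \<in> ball_edges r E m"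
  then obtain j where "j < m" "(u, i, v) \<in> E" "u \<in> ball_vertices r E j \<or> v \<in> ball_vertices r E j"
    by (auto simp: ball_edges_def)
  moreover have "j < n" using \<open>j < m\<close> assms by simp
  ultimately show "(u, i, v) \<in> ball_edges r E n"
    unfolding ball_edges_def by blast
qed

lemma ball_edges_endpoints:
  assumes "(u, i, v) \<in> ball_edges r E n"
  shows "u \<in> ball_vertices r E n \<and> v \<in> ball_vertices r E n"
proof -
  obtain m where "m < n" "(u, i, v) \<in> E" "u \<in> ball_vertices r E m \<or> v \<in> ball_vertices r E m"
    using assms by (auto simp: ball_edges_def)
  then have "u \<in> ball_vertices r E (Suc m) \<and> v \<in> ball_vertices r E (Suc m)"
    by auto
  then show ?thesis
    using ball_vertices_mono[of "Suc m" n r E] \<open>m < n\<close> by auto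
qed

lemma same_balls_0: "same_balls r E r' E' 0"
  unfolding same_balls_def by (intro exI[of _ "\<lambda>_. r'"]) (auto simp: ball_edges_def)

lemma same_balls_trans:
  assumes "same_balls r E r' E' n" "same_balls r' E' r'' E'' n"
  shows "same_balls r E r'' E'' n"
proof -
  obtain f g where
    f: "bij_betw f (ball_vertices r E n) (ball_vertices r' E' n)" "f r = r'"
       "(\<lambda>(u, i, v). (f u, i, f v)) ` ball_edges r E n = ball_edges r' E' n" and
    g: "bij_betw g (ball_vertices r' E' n) (ball_vertices r'' E'' n)" "g r' = r''"
       "(\<lambda>(u, i, v). (g u, i, g v)) ` ball_edges r' E' n = ball_edges r'' E'' n"
    using assms unfolding same_balls_def by metis
  have "(\<lambda>(u, i, v). ((g \<circ> f) u, i, (g \<circ> f) v)) ` ball_edges r E n = ball_edges r'' E'' n"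
    unfolding g(3)[symmetric] f(3)[symmetric] image_image by (rule image_cong) auto
  then show ?thesis
    unfolding same_balls_def using bij_betw_trans[OF f(1) g(1)] f(2) g(2)
    by (intro exI[of _ "g \<circ> f"]) simp
qed

lemma same_balls_sym:
  assumes "same_balls r E r' E' n"
  shows "same_balls r' E' r E n"
proof -
  obtain f where
    f: "bij_betw f (ball_vertices r E n) (ball_vertices r' E' n)" "f r = r'"
       "(\<lambda>(u, i, v). (f u, i, f v)) ` ball_edges r E n = ball_edges r' E' n"
    using assms unfolding same_balls_def by metis
  define g where "g = the_inv_into (ball_vertices r E n) f"
  have gf: "g (f u) = u" if "u \<in> ball_vertices r E n" for u
    using f(1) that unfolding g_def bij_betw_def by (simp add: the_inv_into_f_f)
  have "(\<lambda>(u, i, v). (g u, i, g v)) ` ball_edges r' E' n = (\<lambda>e. e) ` ball_edges r E n"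
    unfolding f(3)[symmetric] image_image
    by (rule image_cong) (auto dest!: ball_edges_endpoints simp: gf)
  moreover have "g r' = r"
    using gf[OF root_in_ball] f(2) by simp
  moreover have "bij_betw g (ball_vertices r' E' n) (ball_vertices r E n)"
    unfolding g_def by (rule bij_betw_the_inv_into[OF f(1)])
  ultimately show ?thesis
    unfolding same_balls_def by (intro exI[of _ g]) simp
qed

lemma same_balls_mono:
  assumes "same_balls r E r' E' n" "m \<le> n"
  shows "same_balls r E r' E' m"
proof -
  obtain f where
    f: "bij_betw f (ball_vertices r E n) (ball_vertices r' E' n)" "f r = r'"
       "(\<lambda>(u, i, v). (f u, i, f v)) ` ball_edges r E n = ball_edges r' E' n"
    using assms unfolding same_balls_def by metis
  have inj: "inj_on f (ball_vertices r E n)"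
    using f(1) by (simp add: bij_betw_def)
  have e1: "(f u, i, f v) \<in> ball_edges r' E' n" if "(u, i, v) \<in> ball_edges r E n" for u i v
    using that f(3) by force
  have e2: "\<exists>u v. u' = f u \<and> v' = f v \<and> (u, i, v) \<in> ball_edges r E n"
    if "(u', i, v') \<in> ball_edges r' E' n" for u' i v'
    using that unfolding f(3)[symmetric] by auto
  have V: "f ` ball_vertices r E j = ball_vertices r' E' j" if "j \<le> n" for j
    using that
  proof (induction j)
    case 0
    then show ?case by (simp add: f(2))
  next
    case (Suc j)
    then have IH: "f ` ball_vertices r E j = ball_vertices r' E' j" and "j < n" by auto
    have bk: "u \<in> ball_vertices r E j"
      if "u \<in> ball_vertices r E n" "f u \<in> ball_vertices r' E' j" for u
      using that IH inj ball_vertices_mono[of j n r E] \<open>j < n\<close>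
      by (metis (no_types, lifting) inj_on_image_mem_iff less_imp_le)
    show ?case
    proof (intro subset_antisym subsetI)
      fix v' assume "v' \<in> f ` ball_vertices r E (Suc j)"
      then obtain v where v: "v' = f v" "v \<in> ball_vertices r E (Suc j)" by blast
      show "v' \<in> ball_vertices r' E' (Suc j)"
      proof (cases "v \<in> ball_vertices r E j")
        case True
        then show ?thesis using IH v(1) by auto
      next
        case False
        then obtain u i where u: "u \<in> ball_vertices r E j" "(u, i, v) \<in> E \<or> (v, i, u) \<in> E"
          using v(2) by auto
        then have "(u, i, v) \<in> ball_edges r E n \<or> (v, i, u) \<in> ball_edges r E n"
          using \<open>j < n\<close> unfolding ball_edges_def by blast
        then have "(f u, i, f v) \<in> E' \<or> (f v, i, f u) \<in> E'"
          using e1 ball_edges_subset by (metis subsetD)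
        moreover have "f u \<in> ball_vertices r' E' j" using u(1) IH by blast
        ultimately show ?thesis using v(1) by auto
      qed
    next
      fix v' assume v': "v' \<in> ball_vertices r' E' (Suc j)"
      show "v' \<in> f ` ball_vertices r E (Suc j)"
      proof (cases "v' \<in> ball_vertices r' E' j")
        case True
        then show ?thesis using IH by auto
      next
        case False
        then obtain u' i where u': "u' \<in> ball_vertices r' E' j" "(u', i, v') \<in> E' \<or> (v', i, u') \<in> E'"
          using v' by auto
        then have "(u', i, v') \<in> ball_edges r' E' n \<or> (v', i, u') \<in> ball_edges r' E' n"
          using \<open>j < n\<close> unfolding ball_edges_def by blast
        then obtain u v where uv: "u' = f u" "v' = f v"
            "(u, i, v) \<in> ball_edges r E n \<or> (v, i, u) \<in> ball_edges r E n"
          using e2 by metis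
        then have "u \<in> ball_vertices r E n"
          using ball_edges_endpoints by metis
        then have "u \<in> ball_vertices r E j"
          using bk u'(1) uv(1) by blast
        then have "v \<in> ball_vertices r E (Suc j)"
          using uv(3) ball_edges_subset[of r E n] by auto
        then show ?thesis using uv(2) by blast
      qed
    qed
  qed
  have bk: "u \<in> ball_vertices r E j"
    if "u \<in> ball_vertices r E n" "f u \<in> ball_vertices r' E' j" "j \<le> n" for u j
    using that V[of j] inj ball_vertices_mono[of j n r E]
    by (metis (no_types, lifting) inj_on_image_mem_iff)
  note sub = ball_edges_mono[OF assms(2), of r E] and sub' = ball_edges_mono[OF assms(2), of r' E']
  have "(\<lambda>(u, i, v). (f u, i, f v)) ` ball_edges r E m = ball_edges r' E' m"
  proof (intro subset_antisym subsetI)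
    fix e assume "e \<in> (\<lambda>(u, i, v). (f u, i, f v)) ` ball_edges r E m"
    then obtain u i v where e: "e = (f u, i, f v)" "(u, i, v) \<in> ball_edges r E m" by auto
    then obtain j where j: "j < m" "u \<in> ball_vertices r E j \<or> v \<in> ball_vertices r E j"
      by (auto simp: ball_edges_def)
    then have "f u \<in> ball_vertices r' E' j \<or> f v \<in> ball_vertices r' E' j"
      using V[of j] assms(2) by auto
    moreover have "(f u, i, f v) \<in> E'"
      using e1 e(2) sub ball_edges_subset by (metis subsetD)
    ultimately show "e \<in> ball_edges r' E' m"
      using e(1) j(1) by (auto simp: ball_edges_def)
  next
    fix e assume e: "e \<in> ball_edges r' E' m"
    obtain u' i v' where e': "e = (u', i, v')" by (cases e) auto
    then obtain u v where uv: "u' = f u" "v' = f v" "(u, i, v) \<in> ball_edges r E n"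
      using e sub' e2 by (metis subsetD)
    obtain j where j: "j < m" "u' \<in> ball_vertices r' E' j \<or> v' \<in> ball_vertices r' E' j"
      using e e' by (auto simp: ball_edges_def)
    then have "u \<in> ball_vertices r E j \<or> v \<in> ball_vertices r E j"
      using bk[of u j] bk[of v j] uv ball_edges_endpoints[OF uv(3)] assms(2) by auto
    then have "(u, i, v) \<in> ball_edges r E m"
      using uv(3) j(1) by (auto simp: ball_edges_def)
    then show "e \<in> (\<lambda>(u, i, v). (f u, i, f v)) ` ball_edges r E m"
      using e' uv by force
  qed
  moreover have "bij_betw f (ball_vertices r E m) (ball_vertices r' E' m)"
    using V[OF assms(2)] inj ball_vertices_mono[OF assms(2), of r E]
    by (auto simp: bij_betw_def intro: inj_on_subset)
  ultimately show ?thesis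
    unfolding same_balls_def using f(2) by blast
qed

lemma same_balls_isomorphic:
  assumes inj: "inj_on f C" and E: "\<And>u i v. (u, i, v) \<in> E \<Longrightarrow> u \<in> C \<and> v \<in> C" and "r \<in> C"
    and E': "E' = (\<lambda>(u, i, v). (f u, i, f v)) ` E"
  shows "same_balls r E (f r) E' n"
proof -
  have fE: "(f u, i, f v) \<in> E'" if "(u, i, v) \<in> E" for u i v
    using that unfolding E' by force
  have Ef: "\<exists>u v. u' = f u \<and> v' = f v \<and> (u, i, v) \<in> E" if "(u', i, v') \<in> E'" for u' i v'
    using that unfolding E' by auto
  have C: "ball_vertices r E j \<subseteq> C" for j
  proof (induction j)
    case (Suc j)
    then show ?case using E unfolding ball_vertices.simps by blast
  qed (simp add: \<open>r \<in> C\<close>)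
  have m: "u \<in> ball_vertices r E j" if "f u \<in> f ` ball_vertices r E j" "u \<in> C" for u j
    using inj_on_image_mem_iff[OF inj that(2) C] that(1) by blast
  have V: "ball_vertices (f r) E' j = f ` ball_vertices r E j" for j
  proof (induction j)
    case (Suc j)
    have "v' \<in> f ` ball_vertices r E (Suc j)" if v': "v' \<in> ball_vertices (f r) E' (Suc j)" for v'
    proof (cases "v' \<in> f ` ball_vertices r E j")
      case False
      then obtain u' i where u': "u' \<in> f ` ball_vertices r E j" "(u', i, v') \<in> E' \<or> (v', i, u') \<in> E'"
        using v' Suc unfolding ball_vertices.simps by blast
      then obtain u v where uv: "u' = f u" "v' = f v" "(u, i, v) \<in> E \<or> (v, i, u) \<in> E"
        using Ef by metis
      then have "u \<in> ball_vertices r E j" using m u'(1) E by blast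
      then show ?thesis using uv unfolding ball_vertices.simps by blast
    qed auto
    moreover have "f v \<in> ball_vertices (f r) E' (Suc j)" if v: "v \<in> ball_vertices r E (Suc j)" for v
    proof (cases "v \<in> ball_vertices r E j")
      case True
      then show ?thesis using Suc by simp
    next
      case False
      then obtain u i where u: "u \<in> ball_vertices r E j" "(u, i, v) \<in> E \<or> (v, i, u) \<in> E"
        using v unfolding ball_vertices.simps by blast
      then have "(f u, i, f v) \<in> E' \<or> (f v, i, f u) \<in> E'" using fE by blast
      moreover have "f u \<in> ball_vertices (f r) E' j" using u(1) Suc by blast
      ultimately show ?thesis unfolding ball_vertices.simps by blast
    qed
    ultimately show ?case by blast
  qed simp
  have "(\<lambda>(u, i, v). (f u, i, f v)) ` ball_edges r E n = ball_edges (f r) E' n"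
  proof (intro subset_antisym subsetI)
    fix x assume "x \<in> (\<lambda>(u, i, v). (f u, i, f v)) ` ball_edges r E n"
    then obtain u i v where x: "x = (f u, i, f v)" "(u, i, v) \<in> ball_edges r E n" by auto
    then obtain k where "k < n" "(u, i, v) \<in> E" "u \<in> ball_vertices r E k \<or> v \<in> ball_vertices r E k"
      by (auto simp: ball_edges_def)
    then have "(f u, i, f v) \<in> E'" "f u \<in> ball_vertices (f r) E' k \<or> f v \<in> ball_vertices (f r) E' k"
      using fE V[of k] by blast+
    then show "x \<in> ball_edges (f r) E' n"
      using x(1) \<open>k < n\<close> unfolding ball_edges_def by blast
  next
    fix x assume x: "x \<in> ball_edges (f r) E' n"
    obtain u' i v' where x': "x = (u', i, v')" by (cases x) auto
    with x obtain k where k: "k < n" "(u', i, v') \<in> E'"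
        "u' \<in> f ` ball_vertices r E k \<or> v' \<in> f ` ball_vertices r E k"
      by (auto simp: ball_edges_def V)
    obtain u v where uv: "u' = f u" "v' = f v" "(u, i, v) \<in> E"
      using Ef k(2) by metis
    have uC: "u \<in> C" and vC: "v \<in> C" using E[OF uv(3)] by simp_all
    have "u \<in> ball_vertices r E k \<or> v \<in> ball_vertices r E k"
      using k(3) m[OF _ uC, of k] m[OF _ vC, of k] unfolding uv(1,2) by metis
    then have "(u, i, v) \<in> ball_edges r E n"
      using uv(3) k(1) unfolding ball_edges_def by blast
    then show "x \<in> (\<lambda>(u, i, v). (f u, i, f v)) ` ball_edges r E n"
      using x' uv by (intro image_eqI[where x = "(u, i, v)"]) auto
  qed
  moreover have "bij_betw f (ball_vertices r E n) (ball_vertices (f r) E' n)"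
    unfolding V bij_betw_def using inj C inj_on_subset by blast
  ultimately show ?thesis
    unfolding same_balls_def by blast
qed


section \<open>The space of marked groups\<close>

text \<open>The entries of the generating list may coincide or be trivial.\<close>

definition marked_group :: "nat \<Rightarrow> 'a monoid \<times> 'a list \<Rightarrow> bool" where
  "marked_group k = (\<lambda>(G, S). group G \<and> length S = k \<and> set S \<subseteq> carrier G \<and>
     generate G (set S) = carrier G)"

definition marked_iso :: "nat \<Rightarrow> (('a monoid \<times> 'a list) \<times> ('a monoid \<times> 'a list)) set" where
  "marked_iso k = {((G, S), (H, T)). marked_group k (G, S) \<and> marked_group k (H, T) \<and>
     (\<exists>h \<in> iso G H. map h S = T)}"

text \<open>Finitely generated groups are countable, so over any infinite type \<open>'a\<close> every marked group
  on \<open>k\<close> generators is represented by a point of the following set.\<close>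

definition marked_groups :: "nat \<Rightarrow> ('a monoid \<times> 'a list) set set" where
  "marked_groups k = Collect (marked_group k) // marked_iso k"

definition cayley_edges :: "'a monoid \<times> 'a list \<Rightarrow> ('a \<times> nat \<times> 'a) set" where
  "cayley_edges = (\<lambda>(G, S). {(g, i, g \<otimes>\<^bsub>G\<^esub> S ! i) | g i. g \<in> carrier G \<and> i < length S})"

definition same_cayley_balls :: "'a monoid \<times> 'a list \<Rightarrow> 'a monoid \<times> 'a list \<Rightarrow> nat \<Rightarrow> bool" where
  "same_cayley_balls p q =
     same_balls \<one>\<^bsub>fst p\<^esub> (cayley_edges p) \<one>\<^bsub>fst q\<^esub> (cayley_edges q)"

definition rep_dist :: "'a monoid \<times> 'a list \<Rightarrow> 'a monoid \<times> 'a list \<Rightarrow> real" where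
  "rep_dist p q = (if \<forall>n. same_cayley_balls p q n then 0
                   else (1 / 2) ^ (GREATEST n. same_cayley_balls p q n))"

text \<open>The choice of representatives is irrelevant, and this is a metric; see
  \<open>marked_dist_class\<close> and \<open>Metric_space_marked_groups\<close>.\<close>

definition marked_dist ::
  "('a monoid \<times> 'a list) set \<Rightarrow> ('a monoid \<times> 'a list) set \<Rightarrow> real" where
  "marked_dist C D = rep_dist (SOME p. p \<in> C) (SOME q. q \<in> D)"

lemma same_cayley_balls_refl: "same_cayley_balls p p n"
  unfolding same_cayley_balls_def
  using same_balls_isomorphic[of id UNIV "cayley_edges p" "\<one>\<^bsub>fst p\<^esub>" "cayley_edges p" n] by simp

lemma same_cayley_balls_sym: "same_cayley_balls p q n \<Longrightarrow> same_cayley_balls q p n"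
  unfolding same_cayley_balls_def by (rule same_balls_sym)

lemma same_cayley_balls_trans:
  "same_cayley_balls p q n \<Longrightarrow> same_cayley_balls q r n \<Longrightarrow> same_cayley_balls p r n"
  unfolding same_cayley_balls_def by (rule same_balls_trans)

lemma rep_dist_le_iff: "rep_dist p q \<le> (1 / 2) ^ n \<longleftrightarrow> same_cayley_balls p q n"
proof (cases "\<forall>n. same_cayley_balls p q n")
  case True
  then show ?thesis by (simp add: rep_dist_def)
next
  case False
  define m where "m = (GREATEST n. same_cayley_balls p q n)"
  obtain N where N: "\<not> same_cayley_balls p q N" using False by blast
  have mono: "same_cayley_balls p q j" if "same_cayley_balls p q l" "j \<le> l" for j l
    using that unfolding same_cayley_balls_def by (rule same_balls_mono)
  have bd: "\<forall>y. same_cayley_balls p q y \<longrightarrow> y \<le> N"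
    using N mono by (meson nat_le_linear)
  note bdr = bd[rule_format]
  have "same_cayley_balls p q 0"
    unfolding same_cayley_balls_def by (rule same_balls_0)
  then have "same_cayley_balls p q m"
    unfolding m_def by (rule GreatestI_nat[of "same_cayley_balls p q", OF _ bdr])
  moreover have "n \<le> m" if "same_cayley_balls p q n"
    unfolding m_def by (rule Greatest_le_nat[of "same_cayley_balls p q", OF that bdr])
  ultimately have "same_cayley_balls p q n \<longleftrightarrow> n \<le> m"
    using mono by blast
  moreover have "rep_dist p q = (1 / 2) ^ m"
    using False by (auto simp: rep_dist_def m_def)
  ultimately show ?thesis
    by (simp add: power_decreasing_iff)
qed

lemma rep_dist_0_iff: "rep_dist p q = 0 \<longleftrightarrow> (\<forall>n. same_cayley_balls p q n)"
  by (simp add: rep_dist_def)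

lemma rep_dist_values: "rep_dist p q = 0 \<or> (\<exists>n. rep_dist p q = (1 / 2) ^ n)"
  unfolding rep_dist_def by auto

lemma rep_dist_ultra: "rep_dist p r \<le> max (rep_dist p q) (rep_dist q r)"
proof -
  have "max (rep_dist p q) (rep_dist q r) = 0 \<or> (\<exists>n. max (rep_dist p q) (rep_dist q r) = (1 / 2) ^ n)"
    using rep_dist_values[of p q] rep_dist_values[of q r] by (metis max_def)
  then show ?thesis
  proof
    assume m: "max (rep_dist p q) (rep_dist q r) = 0"
    have "rep_dist p q \<ge> 0" "rep_dist q r \<ge> 0" by (simp_all add: rep_dist_def)
    then have "rep_dist p q = 0" "rep_dist q r = 0" using m by linarith+
    then have "rep_dist p r = 0"
      unfolding rep_dist_0_iff by (metis same_cayley_balls_trans)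
    then show ?thesis using m by simp
  next
    assume "\<exists>n. max (rep_dist p q) (rep_dist q r) = (1 / 2) ^ n"
    then obtain n where n: "max (rep_dist p q) (rep_dist q r) = (1 / 2) ^ n" by blast
    then have "rep_dist p q \<le> (1 / 2) ^ n" "rep_dist q r \<le> (1 / 2) ^ n" by linarith+
    then have "rep_dist p r \<le> (1 / 2) ^ n"
      unfolding rep_dist_le_iff by (rule same_cayley_balls_trans)
    then show ?thesis using n by simp
  qed
qed

lemma rep_dist_commute: "rep_dist p q = rep_dist q p"
proof -
  have "same_cayley_balls p q = same_cayley_balls q p"
    using same_cayley_balls_sym by blast
  then show ?thesis by (simp add: rep_dist_def)
qed

lemma marked_iso_same_cayley_balls:
  assumes "(p, q) \<in> marked_iso k"
  shows "same_cayley_balls p q n"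
proof -
  obtain G S H T h where p: "p = (G, S)" and q: "q = (H, T)"
    and G: "marked_group k (G, S)" and H: "marked_group k (H, T)"
    and h: "h \<in> iso G H" "map h S = T"
    using assms unfolding marked_iso_def by blast
  interpret G: group G using G by (simp add: marked_group_def)
  interpret H: group H using H by (simp add: marked_group_def)
  have hom: "h \<in> hom G H" and bij: "bij_betw h (carrier G) (carrier H)"
    using h(1) by (auto simp: iso_def)
  have S: "S ! i \<in> carrier G" if "i < length S" for i
    using G that by (auto simp: marked_group_def)
  have mult: "h (g \<otimes>\<^bsub>G\<^esub> S ! i) = h g \<otimes>\<^bsub>H\<^esub> T ! i" if "g \<in> carrier G" "i < length S" for g i
    using that h(2) S hom by (auto simp: hom_mult)
  have len: "length T = length S" using h(2) by auto
  have E: "cayley_edges q = (\<lambda>(u, i, v). (h u, i, h v)) ` cayley_edges p"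
  proof (intro subset_antisym subsetI)
    fix x assume "x \<in> cayley_edges q"
    then obtain g' i where x: "x = (g', i, g' \<otimes>\<^bsub>H\<^esub> T ! i)" "g' \<in> carrier H" "i < length S"
      by (auto simp: cayley_edges_def q len)
    then obtain g where g: "g \<in> carrier G" "g' = h g"
      using bij by (metis bij_betw_imp_surj_on imageE)
    then show "x \<in> (\<lambda>(u, i, v). (h u, i, h v)) ` cayley_edges p"
      using x by (intro image_eqI[where x = "(g, i, g \<otimes>\<^bsub>G\<^esub> S ! i)"])
        (auto simp: cayley_edges_def p mult)
  next
    fix x assume "x \<in> (\<lambda>(u, i, v). (h u, i, h v)) ` cayley_edges p"
    then obtain g i where x: "x = (h g, i, h (g \<otimes>\<^bsub>G\<^esub> S ! i))" "g \<in> carrier G" "i < length S"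
      by (auto simp: cayley_edges_def p)
    then have "h g \<in> carrier H" using bij by (auto simp: bij_betw_def)
    then show "x \<in> cayley_edges q"
      using x mult[of g i] by (auto simp: cayley_edges_def q len)
  qed
  have "same_balls \<one>\<^bsub>G\<^esub> (cayley_edges p) (h \<one>\<^bsub>G\<^esub>) (cayley_edges q) n"
    by (rule same_balls_isomorphic[OF bij_betw_imp_inj_on[OF bij] _ _ E])
      (auto simp: cayley_edges_def p S)
  then show ?thesis
    unfolding same_cayley_balls_def using hom_one[OF hom G.is_group H.is_group] by (simp add: p q)
qed

text \<open>A letter \<open>(i, b)\<close> of a word stands for the generator number \<open>i\<close> if \<open>b\<close> holds and for
  its inverse otherwise.\<close>

primrec word_value :: "'a monoid \<Rightarrow> 'a list \<Rightarrow> (nat \<times> bool) list \<Rightarrow> 'a" where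
  "word_value G S [] = \<one>\<^bsub>G\<^esub>"
| "word_value G S (l # w) =
     (if snd l then S ! fst l else inv\<^bsub>G\<^esub> (S ! fst l)) \<otimes>\<^bsub>G\<^esub> word_value G S w"

lemma word_value_closed:
  assumes "marked_group k (G, S)" "fst ` set w \<subseteq> {..<k}"
  shows "word_value G S w \<in> carrier G"
proof -
  interpret group G using assms(1) by (simp add: marked_group_def)
  have "S ! i \<in> carrier G" if "i < k" for i
    using assms(1) that by (auto simp: marked_group_def)
  then show ?thesis using assms(2) by (induction w) auto
qed

lemma word_value_append:
  assumes "marked_group k (G, S)" "fst ` set v \<subseteq> {..<k}" "fst ` set w \<subseteq> {..<k}"
  shows "word_value G S (v @ w) = word_value G S v \<otimes>\<^bsub>G\<^esub> word_value G S w"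
proof -
  interpret group G using assms(1) by (simp add: marked_group_def)
  have S: "S ! i \<in> carrier G" if "i < k" for i
    using assms(1) that by (auto simp: marked_group_def)
  show ?thesis
    using assms(2)
  proof (induction v)
    case Nil
    then show ?case using word_value_closed[OF assms(1,3)] by simp
  next
    case (Cons l v)
    then show ?case
      using word_value_closed[OF assms(1,3)] word_value_closed[OF assms(1), of v] S
      by (auto simp: m_assoc)
  qed
qed

lemma word_value_surj:
  assumes "marked_group k (G, S)" "g \<in> carrier G"
  shows "\<exists>w. fst ` set w \<subseteq> {..<k} \<and> word_value G S w = g"
proof -
  interpret group G using assms(1) by (simp add: marked_group_def)
  have S: "s \<in> carrier G \<and> (\<exists>i<k. s = S ! i)" if "s \<in> set S" for s
  proof -
    have "s \<in> carrier G" "length S = k"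
      using assms(1) that by (auto simp: marked_group_def)
    then show ?thesis using that in_set_conv_nth[of s S] by auto
  qed
  have "g \<in> generate G (set S)" using assms by (simp add: marked_group_def)
  then show ?thesis
  proof induction
    case one
    show ?case by (intro exI[of _ "[]"]) simp
  next
    case (incl s)
    then obtain i where "i < k" "s = S ! i" using S by blast
    then show ?case using S[OF incl] by (intro exI[of _ "[(i, True)]"]) simp
  next
    case (inv s)
    then obtain i where "i < k" "s = S ! i" using S by blast
    then show ?case using S[OF inv] by (intro exI[of _ "[(i, False)]"]) simp
  next
    case (eng g h)
    then obtain v w where "fst ` set v \<subseteq> {..<k}" "word_value G S v = g"
      "fst ` set w \<subseteq> {..<k}" "word_value G S w = h" by blast
    then show ?case
      using word_value_append[OF assms(1), of v w] by (intro exI[of _ "v @ w"]) auto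
  qed
qed

lemma same_balls_word_value:
  assumes p: "marked_group k (G, S)" and q: "marked_group k (H, T)"
    and f: "f \<one>\<^bsub>G\<^esub> = \<one>\<^bsub>H\<^esub>"
      "\<And>u i v. (u, i, v) \<in> ball_edges \<one>\<^bsub>G\<^esub> (cayley_edges (G, S)) n \<Longrightarrow>
         (f u, i, f v) \<in> cayley_edges (H, T)"
  shows "fst ` set w \<subseteq> {..<k} \<Longrightarrow> length w \<le> n \<Longrightarrow>
    word_value G S w \<in> ball_vertices \<one>\<^bsub>G\<^esub> (cayley_edges (G, S)) (length w) \<and>
    f (word_value G S w) = word_value H T w"
proof (induction w rule: rev_induct)
  case Nil
  then show ?case using f by simp
next
  case (snoc l w)
  interpret G: group G using p by (simp add: marked_group_def)
  interpret H: group H using q by (simp add: marked_group_def)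
  let ?E = "cayley_edges (G, S)" and ?V = "ball_vertices \<one>\<^bsub>G\<^esub> (cayley_edges (G, S))"
  obtain i b where l: "l = (i, b)" by (cases l)
  have i: "i < k" and w: "fst ` set w \<subseteq> {..<k}" and n: "length w < n"
    using snoc.prems l by auto
  have l': "fst ` set [l] \<subseteq> {..<k}" using i l by simp
  have S: "S ! i \<in> carrier G" "i < length S" and T: "T ! i \<in> carrier H" "i < length T"
    using p q i by (auto simp: marked_group_def)
  define g where "g = word_value G S w"
  have g: "g \<in> carrier G" unfolding g_def by (rule word_value_closed[OF p w])
  have g': "word_value H T w \<in> carrier H" by (rule word_value_closed[OF q w])
  have IH: "g \<in> ?V (length w)" "f g = word_value H T w"
    using snoc.IH[OF w] n unfolding g_def by auto
  show ?case
  proof (cases b)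
    case True
    have val: "word_value G S (w @ [l]) = g \<otimes>\<^bsub>G\<^esub> S ! i"
      "word_value H T (w @ [l]) = word_value H T w \<otimes>\<^bsub>H\<^esub> T ! i"
      using word_value_append[OF p w l'] word_value_append[OF q w l'] True S T
      by (simp_all add: l g_def)
    have e: "(g, i, g \<otimes>\<^bsub>G\<^esub> S ! i) \<in> ?E"
      using g S by (auto simp: cayley_edges_def)
    then have "(g, i, g \<otimes>\<^bsub>G\<^esub> S ! i) \<in> ball_edges \<one>\<^bsub>G\<^esub> ?E n"
      using IH(1) n unfolding ball_edges_def by blast
    then have "f (g \<otimes>\<^bsub>G\<^esub> S ! i) = f g \<otimes>\<^bsub>H\<^esub> T ! i"
      using f(2) by (force simp: cayley_edges_def)
    moreover have "g \<otimes>\<^bsub>G\<^esub> S ! i \<in> ?V (Suc (length w))"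
      using e IH(1) unfolding ball_vertices.simps by blast
    ultimately show ?thesis using val IH(2) by simp
  next
    case False
    define h where "h = g \<otimes>\<^bsub>G\<^esub> inv\<^bsub>G\<^esub> (S ! i)"
    have h: "h \<in> carrier G" "h \<otimes>\<^bsub>G\<^esub> S ! i = g"
      using g S unfolding h_def by (auto simp: G.m_assoc)
    have val: "word_value G S (w @ [l]) = h"
      "word_value H T (w @ [l]) = word_value H T w \<otimes>\<^bsub>H\<^esub> inv\<^bsub>H\<^esub> (T ! i)"
      using word_value_append[OF p w l'] word_value_append[OF q w l'] False S T
      by (simp_all add: l g_def h_def)
    have e: "(h, i, g) \<in> ?E"
      using h S by (auto simp: cayley_edges_def)
    then have "(h, i, g) \<in> ball_edges \<one>\<^bsub>G\<^esub> ?E n"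
      using IH(1) n unfolding ball_edges_def by blast
    then have "(f h, i, f g) \<in> cayley_edges (H, T)" by (rule f(2))
    then have fh: "f h \<in> carrier H" "f g = f h \<otimes>\<^bsub>H\<^esub> T ! i"
      by (auto simp: cayley_edges_def)
    then have "f h = f g \<otimes>\<^bsub>H\<^esub> inv\<^bsub>H\<^esub> (T ! i)"
      using T(1) by (simp add: H.m_assoc)
    moreover have "h \<in> ?V (Suc (length w))"
      using e IH(1) unfolding ball_vertices.simps by blast
    ultimately show ?thesis using val IH(2) by simp
  qed
qed

lemma same_cayley_balls_word_value:
  assumes p: "marked_group k (G, S)" and q: "marked_group k (H, T)"
    and same: "\<forall>n. same_cayley_balls (G, S) (H, T) n"
    and v: "fst ` set v \<subseteq> {..<k}" and w: "fst ` set w \<subseteq> {..<k}"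
  shows "word_value G S v = word_value G S w \<longleftrightarrow> word_value H T v = word_value H T w"
proof -
  define n where "n = max (length v) (length w)"
  obtain f where f: "f \<one>\<^bsub>G\<^esub> = \<one>\<^bsub>H\<^esub>"
    "bij_betw f (ball_vertices \<one>\<^bsub>G\<^esub> (cayley_edges (G, S)) n)
       (ball_vertices \<one>\<^bsub>H\<^esub> (cayley_edges (H, T)) n)"
    "(\<lambda>(u, i, v). (f u, i, f v)) ` ball_edges \<one>\<^bsub>G\<^esub> (cayley_edges (G, S)) n =
       ball_edges \<one>\<^bsub>H\<^esub> (cayley_edges (H, T)) n"
    using same[rule_format, of n] unfolding same_cayley_balls_def same_balls_def by auto
  have e: "(f u, i, f v) \<in> cayley_edges (H, T)"
    if "(u, i, v) \<in> ball_edges \<one>\<^bsub>G\<^esub> (cayley_edges (G, S)) n" for u i v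
  proof -
    have "(f u, i, f v) \<in> ball_edges \<one>\<^bsub>H\<^esub> (cayley_edges (H, T)) n"
      unfolding f(3)[symmetric] using that by force
    then show ?thesis by (rule subsetD[OF ball_edges_subset])
  qed
  note val = same_balls_word_value[where f = f and n = n, OF p q f(1) e]
  have "f (word_value G S v) = word_value H T v" "f (word_value G S w) = word_value H T w"
    using val[OF _ v] val[OF _ w] by (auto simp: n_def)
  moreover have "word_value G S u \<in> ball_vertices \<one>\<^bsub>G\<^esub> (cayley_edges (G, S)) n"
    if "fst ` set u \<subseteq> {..<k}" "length u \<le> n" for u
    by (rule subsetD[OF ball_vertices_mono[OF that(2)] conjunct1[OF val[OF _ that]]])
  then have "word_value G S v \<in> ball_vertices \<one>\<^bsub>G\<^esub> (cayley_edges (G, S)) n"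
    "word_value G S w \<in> ball_vertices \<one>\<^bsub>G\<^esub> (cayley_edges (G, S)) n"
    using v w by (auto simp: n_def)
  ultimately show ?thesis
    using f(2) by (metis bij_betw_imp_inj_on inj_onD)
qed

lemma same_cayley_balls_imp_marked_iso:
  assumes p: "marked_group k p" and q: "marked_group k q"
    and same: "\<forall>n. same_cayley_balls p q n"
  shows "(p, q) \<in> marked_iso k"
proof -
  obtain G S H T where eq: "p = (G, S)" "q = (H, T)" by (cases p, cases q)
  note p = p[unfolded eq] and q = q[unfolded eq]
  interpret G: group G using p by (simp add: marked_group_def)
  interpret H: group H using q by (simp add: marked_group_def)
  note wd = same_cayley_balls_word_value[OF p q same[unfolded eq]]
  define word where "word g = (SOME w. fst ` set w \<subseteq> {..<k} \<and> word_value G S w = g)" for g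
  define h where "h g = word_value H T (word g)" for g
  have word: "fst ` set (word g) \<subseteq> {..<k} \<and> word_value G S (word g) = g" if "g \<in> carrier G" for g
    unfolding word_def by (rule someI_ex[OF word_value_surj[OF p that]])
  have h: "h (word_value G S w) = word_value H T w" if "fst ` set w \<subseteq> {..<k}" for w
    unfolding h_def
    using word[OF word_value_closed[OF p that]] wd[OF _ that, of "word (word_value G S w)"] by metis
  have hc: "h g \<in> carrier H" if "g \<in> carrier G" for g
    unfolding h_def using word[OF that] word_value_closed[OF q] by blast
  have "h (g1 \<otimes>\<^bsub>G\<^esub> g2) = h g1 \<otimes>\<^bsub>H\<^esub> h g2" if "g1 \<in> carrier G" "g2 \<in> carrier G" for g1 g2
  proof -
    have "h (word_value G S (word g1 @ word g2)) = word_value H T (word g1 @ word g2)"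
      using word[OF that(1)] word[OF that(2)] by (intro h) auto
    then show ?thesis
      using word[OF that(1)] word[OF that(2)]
      by (simp add: word_value_append[OF p] word_value_append[OF q] h_def)
  qed
  then have "h \<in> hom G H" using hc by (auto simp: hom_def)
  moreover have "inj_on h (carrier G)"
  proof (rule inj_onI)
    fix g1 g2 assume g: "g1 \<in> carrier G" "g2 \<in> carrier G" "h g1 = h g2"
    then have "word_value H T (word g1) = word_value H T (word g2)"
      by (simp add: h_def)
    then show "g1 = g2"
      using wd[of "word g1" "word g2"] word[OF g(1)] word[OF g(2)] by metis
  qed
  moreover have "h ` carrier G = carrier H"
  proof (intro subset_antisym subsetI)
    fix g' assume "g' \<in> carrier H"
    then obtain w where w: "fst ` set w \<subseteq> {..<k}" "word_value H T w = g'"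
      using word_value_surj[OF q] by blast
    then show "g' \<in> h ` carrier G"
      using h[OF w(1)] word_value_closed[OF p w(1)] w(2) by (metis imageI)
  qed (use hc in blast)
  ultimately have "h \<in> iso G H"
    by (simp add: iso_def bij_betw_def)
  moreover have "map h S = T"
  proof (rule nth_equalityI)
    show "length (map h S) = length T" using p q by (simp add: marked_group_def)
    fix i assume "i < length (map h S)"
    then have i: "i < k" "S ! i \<in> carrier G" "T ! i \<in> carrier H"
      using p q by (auto simp: marked_group_def)
    then show "map h S ! i = T ! i"
      using h[of "[(i, True)]"] \<open>i < length (map h S)\<close> by simp
  qed
  ultimately show ?thesis
    using p q unfolding marked_iso_def eq by blast
qed

lemma marked_iso_iff:
  "(p, q) \<in> marked_iso k \<longleftrightarrow>
     marked_group k p \<and> marked_group k q \<and> (\<forall>n. same_cayley_balls p q n)"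
proof
  assume pq: "(p, q) \<in> marked_iso k"
  then have "marked_group k p \<and> marked_group k q"
    by (auto simp: marked_iso_def)
  then show "marked_group k p \<and> marked_group k q \<and> (\<forall>n. same_cayley_balls p q n)"
    using marked_iso_same_cayley_balls[OF pq] by blast
qed (auto intro: same_cayley_balls_imp_marked_iso)

lemma equiv_marked_iso: "equiv (Collect (marked_group k)) (marked_iso k)"
proof (rule equivI)
  show "marked_iso k \<subseteq> Collect (marked_group k) \<times> Collect (marked_group k)"
    by (auto simp: marked_iso_def)
  show "refl_on (Collect (marked_group k)) (marked_iso k)"
    by (auto simp: refl_on_def marked_iso_iff same_cayley_balls_refl)
  show "sym (marked_iso k)"
    by (rule symI) (auto simp: marked_iso_iff intro: same_cayley_balls_sym)
  show "trans (marked_iso k)"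
    by (rule transI) (auto simp: marked_iso_iff intro: same_cayley_balls_trans)
qed

lemma marked_dist_class:
  assumes "marked_group k p" "marked_group k q"
  shows "marked_dist (marked_iso k `` {p}) (marked_iso k `` {q}) = rep_dist p q"
proof -
  have same: "same_cayley_balls p (SOME p'. p' \<in> marked_iso k `` {p}) n"
    if "marked_group k p" for p :: "'a monoid \<times> 'a list" and n
  proof -
    have "p \<in> marked_iso k `` {p}"
      using that by (simp add: marked_iso_iff same_cayley_balls_refl)
    then have "(SOME p'. p' \<in> marked_iso k `` {p}) \<in> marked_iso k `` {p}"
      by (rule someI)
    then have "(p, SOME p'. p' \<in> marked_iso k `` {p}) \<in> marked_iso k"
      by (rule Image_singleton_iff[THEN iffD1])
    then show ?thesis by (rule marked_iso_same_cayley_balls)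
  qed
  have "same_cayley_balls (SOME p'. p' \<in> marked_iso k `` {p}) (SOME q'. q' \<in> marked_iso k `` {q}) =
    same_cayley_balls p q"
    (is "same_cayley_balls ?p ?q = _")
  proof (intro ext iffI)
    fix n
    note p = same[OF assms(1), of n] and q = same[OF assms(2), of n]
    show "same_cayley_balls p q n" if "same_cayley_balls ?p ?q n"
      by (rule same_cayley_balls_trans[OF same_cayley_balls_trans[OF p that]
        same_cayley_balls_sym[OF q]])
    show "same_cayley_balls ?p ?q n" if "same_cayley_balls p q n"
      by (rule same_cayley_balls_trans[OF same_cayley_balls_trans[OF
        same_cayley_balls_sym[OF p] that] q])
  qed
  then show ?thesis
    by (simp add: marked_dist_def rep_dist_def)
qed

lemma Metric_space_marked_groups: "Metric_space (marked_groups k) marked_dist"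
proof
  show "0 \<le> marked_dist C D" for C D :: "('a monoid \<times> 'a list) set"
    by (simp add: marked_dist_def rep_dist_def)
  show "marked_dist C D = marked_dist D C" for C D :: "('a monoid \<times> 'a list) set"
    unfolding marked_dist_def by (rule rep_dist_commute)
next
  fix C D :: "('a monoid \<times> 'a list) set"
  assume "C \<in> marked_groups k" "D \<in> marked_groups k"
  then obtain p q where "marked_group k p" "marked_group k q"
    "C = marked_iso k `` {p}" "D = marked_iso k `` {q}"
    unfolding marked_groups_def by (auto elim!: quotientE)
  then show "marked_dist C D = 0 \<longleftrightarrow> C = D"
    using eq_equiv_class_iff[OF equiv_marked_iso, of p k q]
    by (simp add: marked_dist_class rep_dist_0_iff marked_iso_iff)
next
  fix C D F :: "('a monoid \<times> 'a list) set"
  assume "C \<in> marked_groups k" "D \<in> marked_groups k" "F \<in> marked_groups k"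
  then obtain p q r where "marked_group k p" "marked_group k q" "marked_group k r"
    "C = marked_iso k `` {p}" "D = marked_iso k `` {q}" "F = marked_iso k `` {r}"
    unfolding marked_groups_def by (auto elim!: quotientE)
  moreover have "rep_dist p r \<le> rep_dist p q + rep_dist q r"
  proof -
    have "rep_dist p q \<ge> 0" "rep_dist q r \<ge> 0" by (simp_all add: rep_dist_def)
    then show ?thesis using rep_dist_ultra[of p r q] by linarith
  qed
  ultimately show "marked_dist C F \<le> marked_dist C D + marked_dist D F"
    by (simp add: marked_dist_class)
qed

definition marked_topology :: "nat \<Rightarrow> ('a monoid \<times> 'a list) set topology" where
  "marked_topology k = Metric_space.mtopology (marked_groups k) marked_dist"


section \<open>Automorphisms of the rooted binary tree and the groups in question\<close>

text \<open>The vertices are the words over \<open>{0, 1}\<close>, with \<open>False\<close> for 0 and \<open>True\<close> for 1.\<close>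

definition Aut_T2 :: "(bool list \<Rightarrow> bool list) monoid" where
  "Aut_T2 = \<lparr>carrier = {f. bij f \<and> f [] = [] \<and>
                (\<forall>u v. (\<exists>y. v = u @ [y]) \<longleftrightarrow> (\<exists>y. f v = f u @ [y]))},
             mult = (\<circ>), one = id\<rparr>"

text \<open>The automorphism that acts at each vertex \<open>v\<close> by swapping the two subtrees below \<open>v\<close> if
  \<open>\<sigma> v\<close>, and trivially otherwise: the letter of a word that follows its prefix \<open>v\<close> is flipped
  iff \<open>\<sigma> v\<close>.\<close>

primrec portrait_aut :: "(bool list \<Rightarrow> bool) \<Rightarrow> bool list \<Rightarrow> bool list" where
  "portrait_aut \<sigma> [] = []"
| "portrait_aut \<sigma> (y # w) = (y \<noteq> \<sigma> []) # portrait_aut (\<lambda>v. \<sigma> (y # v)) w"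

lemma Aut_T2_carrier_iff:
  "f \<in> carrier Aut_T2 \<longleftrightarrow> bij f \<and> f [] = [] \<and>
     (\<forall>u v. (\<exists>y. v = u @ [y]) = (\<exists>y. f v = f u @ [y]))"
  unfolding Aut_T2_def partial_object.select_convs mem_Collect_eq by (rule refl)

lemma Aut_T2_simps [simp]: "f \<otimes>\<^bsub>Aut_T2\<^esub> g = f \<circ> g" "\<one>\<^bsub>Aut_T2\<^esub> = id"
  by (simp_all add: Aut_T2_def)

lemma group_Aut_T2: "group Aut_T2"
proof (rule groupI)
  fix f g assume f: "f \<in> carrier Aut_T2" and g: "g \<in> carrier Aut_T2"
  have "bij (f \<circ> g)" "f (g []) = []"
    using f g by (simp_all only: Aut_T2_carrier_iff bij_comp)
  moreover have "(\<exists>y. v = u @ [y]) = (\<exists>y. f (g v) = f (g u) @ [y])" for u v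
    using f g unfolding Aut_T2_carrier_iff by metis
  ultimately show "f \<otimes>\<^bsub>Aut_T2\<^esub> g \<in> carrier Aut_T2"
    unfolding Aut_T2_carrier_iff Aut_T2_simps comp_apply by blast
next
  show "\<one>\<^bsub>Aut_T2\<^esub> \<in> carrier Aut_T2"
    unfolding Aut_T2_carrier_iff by simp
next
  fix f assume f: "f \<in> carrier Aut_T2"
  then have bij: "bij f" and "f [] = []" unfolding Aut_T2_carrier_iff by blast+
  define g where "g = inv_into UNIV f"
  have fg: "f (g v) = v" for v
    unfolding g_def using bij by (simp add: bij_is_surj surj_f_inv_f)
  have gf: "g (f v) = v" for v
    unfolding g_def using bij by (simp add: bij_is_inj inv_f_f)
  have "bij g" unfolding g_def using bij by (rule bij_imp_bij_inv)
  moreover have "g [] = []" using gf[of "[]"] \<open>f [] = []\<close> by simp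
  moreover have "(\<exists>y. v = u @ [y]) = (\<exists>y. g v = g u @ [y])" for u v
  proof -
    have "(\<exists>y. g v = g u @ [y]) = (\<exists>y. f (g v) = f (g u) @ [y])"
      using f unfolding Aut_T2_carrier_iff by blast
    then show ?thesis unfolding fg by (rule sym)
  qed
  ultimately have "g \<in> carrier Aut_T2"
    unfolding Aut_T2_carrier_iff by blast
  moreover have "g \<circ> f = id" using gf by auto
  ultimately show "\<exists>g\<in>carrier Aut_T2. g \<otimes>\<^bsub>Aut_T2\<^esub> f = \<one>\<^bsub>Aut_T2\<^esub>"
    unfolding Aut_T2_simps by blast
qed (simp_all add: comp_assoc)

lemma length_portrait_aut [simp]: "length (portrait_aut \<sigma> w) = length w"
  by (induction w arbitrary: \<sigma>) auto

lemma portrait_aut_snoc: "portrait_aut \<sigma> (u @ [y]) = portrait_aut \<sigma> u @ [y \<noteq> \<sigma> u]"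
  by (induction u arbitrary: \<sigma>) auto

lemma portrait_aut_eq_iff: "portrait_aut \<sigma> v = portrait_aut \<sigma> w \<longleftrightarrow> v = w"
proof (induction v arbitrary: \<sigma> w)
  case Nil
  then show ?case by (cases w) auto
next
  case (Cons y v) note IH = this
  show ?case
  proof (cases w)
    case (Cons z w')
    then show ?thesis using IH[of "\<lambda>v. \<sigma> (y # v)" w'] by (cases "y = z") auto
  qed auto
qed

lemma portrait_aut_surj: "\<exists>v. portrait_aut \<sigma> v = w"
proof (induction w arbitrary: \<sigma>)
  case Nil
  show ?case by (rule exI[of _ "[]"]) simp
next
  case (Cons y w)
  obtain v where "portrait_aut (\<lambda>v. \<sigma> ((y \<noteq> \<sigma> []) # v)) v = w"
    using Cons[of "\<lambda>v. \<sigma> ((y \<noteq> \<sigma> []) # v)"] by blast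
  then show ?case
    by (intro exI[of _ "(y \<noteq> \<sigma> []) # v"]) auto
qed

lemma portrait_aut_in_Aut_T2: "portrait_aut \<sigma> \<in> carrier Aut_T2"
proof -
  have "bij (portrait_aut \<sigma>)"
    using portrait_aut_surj[of \<sigma>] by (auto simp: bij_def inj_def portrait_aut_eq_iff) (metis rangeI)
  moreover have "(\<exists>y. v = u @ [y]) \<longleftrightarrow> (\<exists>y. portrait_aut \<sigma> v = portrait_aut \<sigma> u @ [y])" for u v
  proof
    assume "\<exists>y. portrait_aut \<sigma> v = portrait_aut \<sigma> u @ [y]"
    then show "\<exists>y. v = u @ [y]"
      by (cases v rule: rev_cases) (auto simp: portrait_aut_snoc portrait_aut_eq_iff)
  qed (auto simp: portrait_aut_snoc)
  ultimately show ?thesis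
    unfolding Aut_T2_carrier_iff by (intro conjI allI) simp_all
qed

definition gen_a :: "bool list \<Rightarrow> bool list" where
  "gen_a = portrait_aut (\<lambda>v. v = [])"

text \<open>Sequences are indexed from 0 here: \<open>p n\<close> stands for \<open>p\<^bsub>n+1\<^esub> = P\<close>, the action at the
  vertex \<open>1\<^sup>n0\<close>, and \<open>\<omega> n\<close> for the letter \<open>\<omega>\<^bsub>n+1\<^esub>\<close>.\<close>

definition spine_aut :: "(nat \<Rightarrow> bool) \<Rightarrow> bool list \<Rightarrow> bool list" where
  "spine_aut p = portrait_aut (\<lambda>v. \<exists>n. v = replicate n True @ [False] \<and> p n)"

definition Omega :: "(nat \<Rightarrow> nat) set" where
  "Omega = {\<omega>. \<forall>n. \<omega> n \<in> {0, 1, 2}}"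

definition gen_x :: "bool list \<Rightarrow> bool list" where
  "gen_x = spine_aut (\<lambda>n. True)"

definition gen_b :: "(nat \<Rightarrow> nat) \<Rightarrow> bool list \<Rightarrow> bool list" where
  "gen_b \<omega> = spine_aut (\<lambda>n. \<omega> n \<in> {0, 1})"

definition gen_c :: "(nat \<Rightarrow> nat) \<Rightarrow> bool list \<Rightarrow> bool list" where
  "gen_c \<omega> = spine_aut (\<lambda>n. \<omega> n \<in> {0, 2})"

definition gen_d :: "(nat \<Rightarrow> nat) \<Rightarrow> bool list \<Rightarrow> bool list" where
  "gen_d \<omega> = spine_aut (\<lambda>n. \<omega> n \<in> {1, 2})"

definition S_tilde :: "(nat \<Rightarrow> nat) \<Rightarrow> (bool list \<Rightarrow> bool list) list" where
  "S_tilde \<omega> =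
     [gen_a, gen_b \<omega>, gen_c \<omega>, gen_d \<omega>, gen_x,
      gen_x \<otimes>\<^bsub>Aut_T2\<^esub> gen_b \<omega>, gen_x \<otimes>\<^bsub>Aut_T2\<^esub> gen_c \<omega>, gen_x \<otimes>\<^bsub>Aut_T2\<^esub> gen_d \<omega>]"

definition G_tilde :: "(nat \<Rightarrow> nat) \<Rightarrow> (bool list \<Rightarrow> bool list) monoid" where
  "G_tilde \<omega> = subgroup_generated Aut_T2 (set (S_tilde \<omega>))"

lemma S_tilde_subset_Aut_T2: "set (S_tilde \<omega>) \<subseteq> carrier Aut_T2"
proof -
  interpret group Aut_T2 by (rule group_Aut_T2)
  have m: "f \<otimes>\<^bsub>Aut_T2\<^esub> g \<in> carrier Aut_T2"
    if "f \<in> carrier Aut_T2" "g \<in> carrier Aut_T2" for f g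
    using that by (rule m_closed)
  show ?thesis
    by (simp del: Aut_T2_simps add: m S_tilde_def gen_a_def gen_x_def gen_b_def gen_c_def gen_d_def spine_aut_def
      portrait_aut_in_Aut_T2)
qed

lemma marked_group_G_tilde: "marked_group 8 (G_tilde \<omega>, S_tilde \<omega>)"
proof -
  interpret group Aut_T2 by (rule group_Aut_T2)
  have S: "set (S_tilde \<omega>) \<subseteq> carrier (G_tilde \<omega>)"
    unfolding G_tilde_def
    by (rule subgroup_generated_subset_carrier_subset[OF S_tilde_subset_Aut_T2])
  have "generate (G_tilde \<omega>) (set (S_tilde \<omega>)) = carrier (subgroup_generated (G_tilde \<omega>) (set (S_tilde \<omega>)))"
    using S by (simp add: carrier_subgroup_generated Int_absorb1)
  also have "\<dots> = carrier (G_tilde \<omega>)"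
    by (simp add: G_tilde_def subgroup_generated2)
  finally show ?thesis
    using S by (simp add: marked_group_def S_tilde_def G_tilde_def)
qed

definition X_tilde :: "((bool list \<Rightarrow> bool list) monoid \<times> (bool list \<Rightarrow> bool list) list) set set" where
  "X_tilde = {marked_iso 8 `` {(G_tilde \<omega>, S_tilde \<omega>)} | \<omega>. \<omega> \<in> Omega}"

lemma X_tilde_subset: "X_tilde \<subseteq> marked_groups 8"
  unfolding X_tilde_def marked_groups_def using marked_group_G_tilde by (auto intro: quotientI)

end

theory Submission
  imports Defs
begin

text \<open>
  A word that is trivial in \<open>G_tilde \<omega>\<close> is so because its sections at some depth reduce to products of
  spinal generators, and whether such a product is trivial depends only on the set of letters that
  occur in the remaining tail of \<open>\<omega>\<close>.  Hence a ball in the Cayley graph is determined by a prefix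
  of \<open>\<omega>\<close> together with the set of letters beyond it.  If \<open>\<omega>\<close> is not eventually constant, this
  leaves room to change \<open>\<omega>\<close> far out without changing the ball, so its marked group is not isolated.

  The group of \<open>0\<^sup>\<infinity>\<close> is isolated, because \<open>d = 1\<close> holds for no other \<open>\<omega>\<close>.  A non-isolated point
  \<open>q\<close> of the closure is near infinitely many \<open>G_tilde \<omega>\<close>, and since only finitely many \<open>\<omega>\<close> are
  constant beyond a given position, some of these have at least two letters in the tail; changing
  that tail gives two different groups near \<open>q\<close> that are not isolated.  So removing the isolated
  points once leaves a set without isolated points.

  To see that the two groups differ, let \<open>t\<close> be the generator among \<open>b\<close>, \<open>c\<close>, \<open>d\<close> that is trivial
  at the letter \<open>z\<close>.  If \<open>\<omega>\<close> starts with \<open>z\<close> then \<open>(at)\<^sup>4 = 1\<close>, whereas if it starts with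
  \<open>y z y'\<close>, where \<open>y, y' \<noteq> z\<close>, then \<open>(at)\<^sup>4\<close> does not commute with \<open>(ax)\<^sup>4\<close>.  This
  difference is lifted past a common prefix by a substitution whose parasitic component lies in a
  dihedral group, where squares commute.
\<close>

section \<open>Generators and words\<close>

lemma portrait_aut_trivial: "portrait_aut (\<lambda>_. False) w = w"
  by (induction w) auto

lemma gen_a_simps [simp]: "gen_a [] = []" "gen_a (y # v) = (\<not> y) # v"
  by (simp_all add: gen_a_def portrait_aut_trivial)

lemma spine_aut_Nil [simp]: "spine_aut p [] = []"
  by (simp add: spine_aut_def)

lemma spine_aut_True [simp]: "spine_aut p (True # v) = True # spine_aut (\<lambda>n. p (Suc n)) v"
proof -
  have "(\<exists>n. True # u = replicate n True @ [False] \<and> p n) \<longleftrightarrow>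
      (\<exists>n. u = replicate n True @ [False] \<and> p (Suc n))"
    (is "?l \<longleftrightarrow> ?r") for u
  proof
    assume ?l
    then obtain n where "True # u = replicate n True @ [False] \<and> p n" by blast
    then show ?r by (cases n) auto
  next
    assume ?r
    then obtain n where "u = replicate n True @ [False] \<and> p (Suc n)" by blast
    then show ?l by (intro exI[of _ "Suc n"]) simp
  qed
  then show ?thesis
    by (simp add: spine_aut_def)
qed

lemma spine_aut_False [simp]: "spine_aut p (False # v) = False # (if p 0 then gen_a v else v)"
proof -
  have "(\<exists>n. False # u = replicate n True @ [False] \<and> p n) \<longleftrightarrow> u = [] \<and> p 0"
    (is "?l \<longleftrightarrow> ?r") for u
  proof
    assume ?l
    then obtain n where "False # u = replicate n True @ [False] \<and> p n" by blast
    then show ?r by (cases n) auto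
  next
    assume ?r
    then show ?l by (intro exI[of _ 0]) simp
  qed
  then show ?thesis
    by (simp add: spine_aut_def gen_a_def portrait_aut_trivial)
qed

lemma gen_a_involution [simp]: "gen_a (gen_a v) = v"
  by (cases v) auto

lemma spine_aut_comp: "spine_aut p (spine_aut q v) = spine_aut (\<lambda>n. p n \<noteq> q n) v"
proof (induction v arbitrary: p q)
  case (Cons y v)
  then show ?case by (cases y) auto
qed simp

lemma spine_aut_trivial: "spine_aut (\<lambda>_. False) v = v"
proof (induction v)
  case (Cons y v)
  then show ?case by (cases y) auto
qed simp

lemma spine_aut_involution [simp]: "spine_aut p (spine_aut p v) = v"
  by (simp add: spine_aut_comp spine_aut_trivial)

lemma spine_aut_at: "spine_aut p (replicate n True @ [False, y]) = replicate n True @ [False, y \<noteq> p n]"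
  by (induction n arbitrary: p) auto

lemma spine_aut_eq_id_iff: "spine_aut p = id \<longleftrightarrow> (\<forall>n. \<not> p n)"
proof
  assume "spine_aut p = id"
  then show "\<forall>n. \<not> p n"
    using spine_aut_at[of p _ True] by (metis append_Cons append_same_eq id_apply list.inject same_append_eq)
next
  assume "\<forall>n. \<not> p n"
  then have "p = (\<lambda>_. False)" by auto
  then show "spine_aut p = id" by (auto simp: spine_aut_trivial)
qed

text \<open>\<open>gen_bit l z\<close> tells whether the sequence of generator number \<open>l \<in> {1..7}\<close> has a \<open>P\<close> at the
  positions where \<open>\<omega>\<close> has the letter \<open>z\<close>.\<close>

definition gen_bit :: "nat \<Rightarrow> nat \<Rightarrow> bool" where
  "gen_bit l z = [False, z \<in> {0, 1}, z \<in> {0, 2}, z \<in> {1, 2}, True,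
     z \<notin> {0, 1}, z \<notin> {0, 2}, z \<notin> {1, 2}] ! l"

definition gen :: "(nat \<Rightarrow> nat) \<Rightarrow> nat \<Rightarrow> bool list \<Rightarrow> bool list" where
  "gen \<omega> l = (if l = 0 then gen_a else spine_aut (\<lambda>n. gen_bit l (\<omega> n)))"

abbreviation shift :: "(nat \<Rightarrow> nat) \<Rightarrow> nat \<Rightarrow> nat" where
  "shift \<omega> \<equiv> \<lambda>n. \<omega> (Suc n)"

lemma gen_simps [simp]:
  "gen \<omega> l [] = []"
  "gen \<omega> 0 (y # v) = (\<not> y) # v"
  "l \<noteq> 0 \<Longrightarrow> gen \<omega> l (True # v) = True # gen (shift \<omega>) l v"
  "l \<noteq> 0 \<Longrightarrow> gen \<omega> l (False # v) = False # (if gen_bit l (\<omega> 0) then gen_a v else v)"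
  by (simp_all add: gen_def)

lemma gen_involution [simp]: "gen \<omega> l (gen \<omega> l v) = v"
  by (simp add: gen_def)

lemma less_8_cases:
  assumes "l < (8::nat)"
  obtains "l = 0" | "l = 1" | "l = 2" | "l = 3" | "l = 4" | "l = 5" | "l = 6" | "l = 7"
  using assms by linarith

lemma S_tilde_nth: "l < 8 \<Longrightarrow> S_tilde \<omega> ! l = gen \<omega> l"
  by (erule less_8_cases)
    (simp_all add: S_tilde_def gen_def gen_bit_def gen_b_def gen_c_def gen_d_def gen_x_def
      spine_aut_comp fun_eq_iff)

text \<open>Letters carry no sign because every generator is an involution; the last letter of a
  word acts first.\<close>

primrec ev :: "(nat \<Rightarrow> nat) \<Rightarrow> nat list \<Rightarrow> bool list \<Rightarrow> bool list" where
  "ev \<omega> [] v = v"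
| "ev \<omega> (l # w) v = gen \<omega> l (ev \<omega> w v)"

lemma ev_append: "ev \<omega> (u @ w) v = ev \<omega> u (ev \<omega> w v)"
  by (induction u) auto

lemma ev_rev: "ev \<omega> (rev w) (ev \<omega> w v) = v"
  by (induction w) (auto simp: ev_append)

lemma ev_rev': "ev \<omega> w (ev \<omega> (rev w) v) = v"
  using ev_rev[of \<omega> "rev w" v] by simp

text \<open>Reversing a word inverts it. Equality of two words thus becomes triviality of one, at
  the cost of adding the lengths.\<close>

lemma ev_eq_iff: "ev \<omega> u = ev \<omega> w \<longleftrightarrow> ev \<omega> (rev u @ w) = id"
proof
  assume "ev \<omega> u = ev \<omega> w"
  then show "ev \<omega> (rev u @ w) = id"
    by (metis ev_append ev_rev eq_id_iff)
next
  assume "ev \<omega> (rev u @ w) = id"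
  then have "ev \<omega> w v = ev \<omega> u v" for v
    by (metis ev_append ev_rev' eq_id_iff)
  then show "ev \<omega> u = ev \<omega> w" by auto
qed

lemma word_value_G_tilde:
  assumes "fst ` set w \<subseteq> {..<8}"
  shows "word_value (G_tilde \<omega>) (S_tilde \<omega>) w = ev \<omega> (map fst w)"
  using assms
proof (induction w)
  case Nil
  then show ?case by (auto simp: G_tilde_def)
next
  case (Cons l w)
  have group: "group (G_tilde \<omega>)"
    using marked_group_G_tilde[of \<omega>] by (simp add: marked_group_def)
  have l: "fst l < 8" using Cons.prems by simp
  have "S_tilde \<omega> ! fst l \<in> carrier (G_tilde \<omega>)"
    using marked_group_G_tilde[of \<omega>] l by (auto simp: marked_group_def)
  moreover have "gen \<omega> (fst l) \<circ> gen \<omega> (fst l) = id" by auto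
  ultimately have "inv\<^bsub>G_tilde \<omega>\<^esub> (S_tilde \<omega> ! fst l) = S_tilde \<omega> ! fst l"
    using group l by (intro group.inv_equality) (auto simp: G_tilde_def S_tilde_nth)
  then show ?case
    using Cons l by (auto simp: G_tilde_def S_tilde_nth)
qed

section \<open>Locality of the word problem\<close>

text \<open>Only \<open>a\<close> moves the first letter of a vertex, so this parity says whether a
  word swaps the two subtrees at the root.\<close>

definition odd_as :: "nat list \<Rightarrow> bool" where
  "odd_as w = odd (length (filter (\<lambda>l. l = 0) w))"

text \<open>The section at the vertex \<open>y\<close>, where \<open>z\<close> is the first letter
  of the sequence. When \<open>l\<close> acts, \<open>w\<close> has already turned \<open>y\<close>
  into \<open>y \<noteq> odd_as w\<close>; in the subtree at 1 a spinal letter persists, in the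
  subtree at 0 it becomes \<open>a\<close> or disappears.\<close>

primrec section_word :: "nat \<Rightarrow> bool \<Rightarrow> nat list \<Rightarrow> nat list" where
  "section_word z y [] = []"
| "section_word z y (l # w) =
     (if l = 0 then []
      else if y \<noteq> odd_as w then [l]
      else if gen_bit l z then [0] else []) @ section_word z y w"

lemma ev_Cons: "ev \<omega> w (y # v) = (y \<noteq> odd_as w) # ev (shift \<omega>) (section_word (\<omega> 0) y w) v"
proof (induction w)
  case (Cons l w)
  have "gen_a v = gen \<omega> 0 v" for v \<omega> by (simp add: gen_def)
  then show ?case
    using Cons by (cases "l = 0"; cases "y \<noteq> odd_as w") (auto simp: odd_as_def)
qed (simp add: odd_as_def)

lemma length_section_word: "length (section_word z y w) \<le> length (filter (\<lambda>l. l \<noteq> 0) w)"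
  by (induction w) auto

lemma ev_eq_id_iff:
  "ev \<omega> w = id \<longleftrightarrow> \<not> odd_as w \<and> (\<forall>y. ev (shift \<omega>) (section_word (\<omega> 0) y w) = id)"
proof
  assume "ev \<omega> w = id"
  then show "\<not> odd_as w \<and> (\<forall>y. ev (shift \<omega>) (section_word (\<omega> 0) y w) = id)"
    using ev_Cons[of \<omega> w] by (auto simp: fun_eq_iff)
next
  assume *: "\<not> odd_as w \<and> (\<forall>y. ev (shift \<omega>) (section_word (\<omega> 0) y w) = id)"
  have "ev \<omega> w [] = []" by (induction w) auto
  then have "ev \<omega> w v = v" for v
    using * by (cases v) (auto simp: ev_Cons)
  then show "ev \<omega> w = id" by auto
qed

primrec word_bit :: "nat list \<Rightarrow> nat \<Rightarrow> bool" where
  "word_bit [] z = False"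
| "word_bit (l # w) z = (gen_bit l z \<noteq> word_bit w z)"

text \<open>Spinal automorphisms multiply by adding their sequences modulo 2.\<close>

lemma ev_spine: "0 \<notin> set w \<Longrightarrow> ev \<omega> w = spine_aut (\<lambda>n. word_bit w (\<omega> n))"
  by (induction w) (auto simp: spine_aut_trivial gen_def spine_aut_comp)

text \<open>The sections of a word that contains \<open>a\<close> are shorter than the word, and a word without \<open>a\<close>
  only sees the set of letters of \<open>\<omega>\<close>.\<close>

lemma ev_local:
  assumes "\<And>i. i < L \<Longrightarrow> \<omega> i = \<omega>' i" "\<omega> ` {L..} = \<omega>' ` {L..}" "length w \<le> L"
  shows "ev \<omega> w = id \<longleftrightarrow> ev \<omega>' w = id"
  using assms
proof (induction L arbitrary: \<omega> \<omega>' w)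
  case 0
  then show ?case by (auto simp: fun_eq_iff)
next
  case (Suc L)
  show ?case
  proof (cases "0 \<in> set w")
    case True
    have "{Suc L..} = Suc ` {L..}"
      by (auto dest: Suc_le_D)
    then have "(\<lambda>n. \<omega> (Suc n)) ` {L..} = (\<lambda>n. \<omega>' (Suc n)) ` {L..}"
      using Suc.prems(2) by (simp add: image_image)
    moreover have "filter (\<lambda>l. l = 0) w \<noteq> []"
      using True by (auto simp: filter_empty_conv)
    then have "length (filter (\<lambda>l. l = 0) w) > 0" by blast
    then have "length (section_word (\<omega> 0) y w) \<le> L" for y
      using length_section_word[of "\<omega> 0" y w] Suc.prems(3)
        sum_length_filter_compl[of "\<lambda>l. l = 0" w] by linarith
    moreover have "\<omega> 0 = \<omega>' 0" using Suc.prems(1) by simp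
    ultimately have "ev (shift \<omega>) (section_word (\<omega> 0) y w) = id \<longleftrightarrow>
        ev (shift \<omega>') (section_word (\<omega>' 0) y w) = id" for y
      using Suc.IH[of "shift \<omega>" "shift \<omega>'" "section_word (\<omega> 0) y w"] Suc.prems(1) by (simp add: id_def)
    then show ?thesis unfolding ev_eq_id_iff[of \<omega> w] ev_eq_id_iff[of \<omega>' w] by blast
  next
    case False
    have "range \<omega> = \<omega> ` {..<Suc L} \<union> \<omega> ` {Suc L..}" for \<omega> :: "nat \<Rightarrow> nat"
      unfolding image_Un[symmetric] by (rule arg_cong[where f = "image \<omega>"]) auto
    moreover have "\<omega> ` {..<Suc L} = \<omega>' ` {..<Suc L}"
      using Suc.prems(1) by (intro image_cong) auto
    ultimately have "range \<omega> = range \<omega>'" using Suc.prems(2) by metis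
    then have "(\<forall>n. \<not> word_bit w (\<omega> n)) \<longleftrightarrow> (\<forall>n. \<not> word_bit w (\<omega>' n))"
      by (metis rangeE rangeI)
    then show ?thesis
      unfolding ev_spine[OF False] spine_aut_eq_id_iff .
  qed
qed

section \<open>Distinguishing the groups\<close>

text \<open>The substitution \<open>a \<mapsto> x\<close>, \<open>s \<mapsto> a s a\<close> acts on the subtree at 0 as the original word for the
  shifted sequence, and on the subtree at 1 as an element of the dihedral group \<open>\<langle>a, x\<rangle>\<close>.\<close>

definition lift :: "nat list \<Rightarrow> nat list" where
  "lift w = concat (map (\<lambda>l. if l = 0 then [4] else [0, l, 0]) w)"

lemma lift_simps [simp]:
  "lift [] = []" "lift (l # w) = (if l = 0 then [4] else [0, l, 0]) @ lift w"
  by (simp_all add: lift_def)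

lemma lift_alphabet: "set w \<subseteq> {..<8} \<Longrightarrow> set (lift w) \<subseteq> {..<8}"
  by (induction w) auto

lemma lift_append: "lift (u @ w) = lift u @ lift w"
  by (induction u) auto

lemma gen_bit_4 [simp]: "gen_bit 4 z"
  by (simp add: gen_bit_def)

lemma gen_a_eq_gen: "gen_a v = gen \<omega> 0 v"
  by (simp add: gen_def)

text \<open>In the subtree at 0, \<open>x\<close> acts as \<open>a\<close>, while conjugation by
  \<open>a\<close> brings there the action of \<open>l\<close> at 1, which is \<open>l\<close> for
  the shifted sequence.\<close>

lemma ev_lift_False: "ev \<omega> (lift w) (False # v) = False # ev (shift \<omega>) w v"
  by (induction w) (auto simp: gen_a_eq_gen[of _ "shift \<omega>"])

text \<open>The section of \<open>lift w\<close> at 1: \<open>x\<close> persists, and the conjugate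
  of \<open>l\<close> acts as \<open>l\<close> does at 0, by \<open>a\<close> or trivially.\<close>

definition dihedral_word :: "(nat \<Rightarrow> nat) \<Rightarrow> nat list \<Rightarrow> nat list" where
  "dihedral_word \<omega> w = concat (map (\<lambda>l. if l = 0 then [4] else if gen_bit l (\<omega> 0) then [0] else []) w)"

lemma ev_lift_True: "ev \<omega> (lift w) (True # v) = True # ev (shift \<omega>) (dihedral_word \<omega> w) v"
  by (induction w) (auto simp: gen_a_eq_gen[of _ "shift \<omega>"] dihedral_word_def)

lemma dihedral_word_append: "dihedral_word \<omega> (u @ w) = dihedral_word \<omega> u @ dihedral_word \<omega> w"
  by (simp add: dihedral_word_def)

lemma set_dihedral_word: "set (dihedral_word \<omega> w) \<subseteq> {0, 4}"
  by (auto simp: dihedral_word_def split: if_splits)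

text \<open>For involutions \<open>f\<close> and \<open>g\<close> these are the elements of the
  dihedral group that they generate: first the rotations, then the reflections.\<close>

definition alternating :: "('a \<Rightarrow> 'a) \<Rightarrow> ('a \<Rightarrow> 'a) \<Rightarrow> ('a \<Rightarrow> 'a) \<Rightarrow> bool" where
  "alternating f g e \<longleftrightarrow> (\<exists>k. e = (f \<circ> g) ^^ k \<or> e = (g \<circ> f) ^^ k \<or>
     e = f \<circ> (g \<circ> f) ^^ k \<or> e = g \<circ> (f \<circ> g) ^^ k)"

lemma alternating_commute: "alternating f g e \<longleftrightarrow> alternating g f e"
  unfolding alternating_def by blast

lemma alternating_comp:
  assumes f: "f \<circ> f = id" and "alternating f g e"
  shows "alternating f g (f \<circ> e)"
proof -
  have ff: "f \<circ> (f \<circ> h) = h" for h using f by (metis comp_assoc id_comp)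
  obtain k where "e = (f \<circ> g) ^^ k \<or> e = (g \<circ> f) ^^ k \<or> e = f \<circ> (g \<circ> f) ^^ k \<or> e = g \<circ> (f \<circ> g) ^^ k"
    using assms(2) unfolding alternating_def by blast
  \<comment> \<open>Exponent 0 is split off because only a positive power of
    \<open>f \<circ> g\<close> begins with an \<open>f\<close> that can cancel.\<close>
  then consider "k = 0" "e = (f \<circ> g) ^^ k" | m where "e = (f \<circ> g) ^^ Suc m" | "e = (g \<circ> f) ^^ k"
    | "e = f \<circ> (g \<circ> f) ^^ k" | "e = g \<circ> (f \<circ> g) ^^ k"
    by (metis not0_implies_Suc)
  then show ?thesis
  proof cases
    case 1
    then have "f \<circ> e = f \<circ> (g \<circ> f) ^^ 0" by simp
    then show ?thesis unfolding alternating_def by blast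
  next
    case (2 m)
    have "f \<circ> e = g \<circ> (f \<circ> g) ^^ m"
      unfolding 2 funpow.simps comp_assoc ff ..
    then show ?thesis unfolding alternating_def by blast
  next
    case 3
    then show ?thesis unfolding alternating_def by blast
  next
    case 4
    then have "f \<circ> e = (g \<circ> f) ^^ k" by (simp only: ff)
    then show ?thesis unfolding alternating_def by blast
  next
    case 5
    then have "f \<circ> e = (f \<circ> g) ^^ Suc k" by (simp only: funpow.simps comp_assoc)
    then show ?thesis unfolding alternating_def by blast
  qed
qed

lemma funpow_comp_inverse:
  assumes "f \<circ> f = id" "g \<circ> g = id"
  shows "(f \<circ> g) ^^ k \<circ> (g \<circ> f) ^^ k = id"
proof (induction k)
  case (Suc k)
  have "(f \<circ> g) ^^ Suc k \<circ> (g \<circ> f) ^^ Suc k = (f \<circ> g) ^^ k \<circ> (f \<circ> (g \<circ> g) \<circ> f) \<circ> (g \<circ> f) ^^ k"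
    unfolding funpow_Suc_right[where n = k and f = "f \<circ> g"] funpow.simps(2)[where n = k and f = "g \<circ> f"]
    by (simp only: comp_assoc)
  also have "f \<circ> (g \<circ> g) \<circ> f = id" using assms by simp
  finally show ?case using Suc by (simp only: comp_id)
qed simp

text \<open>A rotation squares to a rotation. A reflection is a palindrome in \<open>f\<close> and
  \<open>g\<close>, so its square collapses to the identity, the power with exponent 0.\<close>

lemma alternating_square:
  assumes fg: "f \<circ> f = id" "g \<circ> g = id" and "alternating f g e"
  shows "\<exists>k. e \<circ> e = (f \<circ> g) ^^ k \<or> e \<circ> e = (g \<circ> f) ^^ k"
proof -
  have flip: "(f \<circ> g) ^^ k \<circ> f = f \<circ> (g \<circ> f) ^^ k" for f g :: "'a \<Rightarrow> 'a" and k
    by (induction k) (auto simp: fun_eq_iff)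
  have reflection: "e \<circ> e = (f \<circ> g) ^^ 0"
    if "e = f \<circ> (g \<circ> f) ^^ k" and fg: "f \<circ> f = id" "g \<circ> g = id" for f g :: "'a \<Rightarrow> 'a" and k
  proof -
    have "e \<circ> e = (f \<circ> g) ^^ k \<circ> (f \<circ> f) \<circ> (g \<circ> f) ^^ k"
      using that(1) flip[where f = f and g = g and k = k] by (metis comp_assoc)
    then show ?thesis using funpow_comp_inverse[OF fg] fg by simp
  qed
  obtain k where "e = (f \<circ> g) ^^ k \<or> e = (g \<circ> f) ^^ k \<or> e = f \<circ> (g \<circ> f) ^^ k \<or> e = g \<circ> (f \<circ> g) ^^ k"
    using assms(3) unfolding alternating_def by blast
  then show ?thesis
    by (elim disjE) (metis funpow_add, metis funpow_add, metis reflection fg, metis reflection fg)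
qed

text \<open>The square of an element of a dihedral group is a rotation, and rotations commute.\<close>

lemma alternating_squares_commute:
  assumes fg: "f \<circ> f = id" "g \<circ> g = id" and "alternating f g e" "alternating f g h"
  shows "(e \<circ> e) \<circ> (h \<circ> h) = (h \<circ> h) \<circ> (e \<circ> e)"
proof -
  have power: "p ^^ k \<circ> q = q \<circ> p ^^ k" if "p \<circ> q = q \<circ> p" for p q :: "'a \<Rightarrow> 'a" and k
    using that by (induction k) (auto simp: fun_eq_iff)
  \<comment> \<open>The two basic rotations are mutually inverse, so they commute, and so do their
    powers.\<close>
  have "(f \<circ> g) \<circ> (g \<circ> f) = id" "(g \<circ> f) \<circ> (f \<circ> g) = id"
    using funpow_comp_inverse[OF fg, of 1] funpow_comp_inverse[OF fg(2,1), of 1] by simp_all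
  then have "(f \<circ> g) ^^ k \<circ> (g \<circ> f) ^^ l = (g \<circ> f) ^^ l \<circ> (f \<circ> g) ^^ k" for k l
    using power[OF power[symmetric]] by metis
  moreover have "r ^^ k \<circ> r ^^ l = r ^^ l \<circ> r ^^ k" for r :: "'a \<Rightarrow> 'a" and k l
    by (metis funpow_add add.commute)
  ultimately show ?thesis
    using alternating_square[OF fg assms(3)] alternating_square[OF fg assms(4)] by metis
qed

lemma ev_dihedral:
  "set w \<subseteq> {l, m} \<Longrightarrow> alternating (gen \<omega> l) (gen \<omega> m) (ev \<omega> w)"
proof (induction w)
  case Nil
  have "ev \<omega> [] = (gen \<omega> l \<circ> gen \<omega> m) ^^ 0" by auto
  then show ?case unfolding alternating_def by blast
next
  case (Cons i w)
  have "gen \<omega> i \<circ> gen \<omega> i = id" "ev \<omega> (i # w) = gen \<omega> i \<circ> ev \<omega> w" by auto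
  moreover have "i = l \<or> i = m" using Cons.prems by auto
  moreover have "alternating (gen \<omega> l) (gen \<omega> m) (ev \<omega> w)" using Cons by simp
  ultimately show ?case
    using alternating_comp alternating_commute by metis
qed

text \<open>The relation that separates the groups. As an equality of two words it holds at both or
  neither of two equal points.\<close>

definition fourth_powers_commute :: "(nat \<Rightarrow> nat) \<Rightarrow> nat list \<Rightarrow> nat list \<Rightarrow> bool" where
  "fourth_powers_commute \<omega> u w \<longleftrightarrow>
     ev \<omega> (u @ u @ u @ u @ w @ w @ w @ w) = ev \<omega> (w @ w @ w @ w @ u @ u @ u @ u)"

lemma all_bool_list_iff: "(\<forall>v. P v) \<longleftrightarrow> P [] \<and> (\<forall>v. P (True # v)) \<and> (\<forall>v. P (False # v))"
  by (metis (full_types) list.exhaust)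

text \<open>In the subtree at 1 both sides always agree: a fourth power is the square of the
  dihedral element given by \<open>u @ u\<close>, and such squares commute. Only the subtree at 0
  decides.\<close>

lemma fourth_powers_commute_lift:
  "fourth_powers_commute \<omega> (lift u) (lift w) \<longleftrightarrow> fourth_powers_commute (shift \<omega>) u w"
proof -
  let ?P = "u @ u @ u @ u @ w @ w @ w @ w" and ?Q = "w @ w @ w @ w @ u @ u @ u @ u"
  let ?D = "dihedral_word \<omega>"
  have D: "set (?D (u @ u)) \<subseteq> {0, 4}" "set (?D (w @ w)) \<subseteq> {0, 4}"
    using set_dihedral_word by blast+
  have "gen (shift \<omega>) 0 \<circ> gen (shift \<omega>) 0 = id" "gen (shift \<omega>) 4 \<circ> gen (shift \<omega>) 4 = id"
    by auto
  from alternating_squares_commute[OF this ev_dihedral[OF D(1), of "shift \<omega>"] ev_dihedral[OF D(2), of "shift \<omega>"]]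
  have "ev (shift \<omega>) (?D ?P) = ev (shift \<omega>) (?D ?Q)"
    by (simp add: dihedral_word_append ev_append fun_eq_iff)
  then have "ev \<omega> (lift ?P) (True # v) = ev \<omega> (lift ?Q) (True # v)" for v
    by (simp add: ev_lift_True)
  moreover have "ev \<omega> w [] = []" for w by (induction w) auto
  then have "ev \<omega> (lift ?P) [] = ev \<omega> (lift ?Q) []" by simp
  ultimately have "ev \<omega> (lift ?P) = ev \<omega> (lift ?Q) \<longleftrightarrow> (\<forall>v. ev \<omega> (lift ?P) (False # v) = ev \<omega> (lift ?Q) (False # v))"
    unfolding fun_eq_iff[of "ev \<omega> (lift ?P)"] by (subst all_bool_list_iff) blast
  also have "\<dots> \<longleftrightarrow> ev (shift \<omega>) ?P = ev (shift \<omega>) ?Q"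
    by (auto simp: ev_lift_False)
  finally show ?thesis
    by (simp add: fourth_powers_commute_def lift_append)
qed

lemma fourth_powers_commute_lift_iterated:
  "fourth_powers_commute \<omega> ((lift ^^ n) u) ((lift ^^ n) w) \<longleftrightarrow>
     fourth_powers_commute (\<lambda>k. \<omega> (n + k)) u w"
proof (induction n arbitrary: \<omega>)
  case (Suc n)
  then show ?case by (simp add: fourth_powers_commute_lift)
qed simp

text \<open>The generator among \<open>b, c, d\<close> whose sequence has an \<open>I\<close> exactly where \<open>\<omega>\<close> has the letter \<open>z\<close>.\<close>

definition dead_gen :: "nat \<Rightarrow> nat" where
  "dead_gen z = 3 - z"

lemma gen_bit_dead_gen: "z \<in> {0, 1, 2} \<Longrightarrow> z' \<in> {0, 1, 2} \<Longrightarrow> gen_bit (dead_gen z) z' \<longleftrightarrow> z' \<noteq> z"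
  by (auto simp: gen_bit_def dead_gen_def)

text \<open>Let \<open>t\<close> be the generator \<open>dead_gen z\<close>. It acts trivially on
  the subtree at 0, so the square of \<open>at\<close> acts on both subtrees as the shifted
  \<open>t\<close>, an involution. Hence the fourth power of \<open>at\<close> is trivial.\<close>

lemma fourth_powers_commute_dead:
  assumes "z \<in> {0, 1, 2}" "\<omega> 0 = z"
  shows "fourth_powers_commute \<omega> [0, dead_gen z] w"
proof -
  have t: "dead_gen z \<noteq> 0" "\<not> gen_bit (dead_gen z) (\<omega> 0)"
    using assms gen_bit_dead_gen[of z z] by (auto simp: dead_gen_def)
  let ?u = "[0, dead_gen z]"
  have "ev \<omega> (?u @ ?u @ ?u @ ?u) v = v" for v
  proof (cases v)
    case (Cons y v)
    then show ?thesis using t by (cases y) auto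
  qed simp
  then show ?thesis
    by (simp add: fourth_powers_commute_def ev_append fun_eq_iff del: append_Cons append_Nil)
qed

text \<open>On the subtree at 00 the fourth power of \<open>at\<close> acts as \<open>t\<close> for
  the sequence shifted twice, that of \<open>ax\<close> as \<open>ax\<close> for that sequence. The
  former has a \<open>P\<close> in first position and so does not commute with \<open>ax\<close>;
  the vertex 0001 detects this.\<close>

lemma not_fourth_powers_commute:
  assumes "z \<in> {0, 1, 2}" "\<omega> 1 = z" "\<omega> 0 \<in> {0, 1, 2} - {z}" "\<omega> 2 \<in> {0, 1, 2} - {z}"
  shows "\<not> fourth_powers_commute \<omega> [0, dead_gen z] [0, 4]"
proof
  assume *: "fourth_powers_commute \<omega> [0, dead_gen z] [0, 4]"
  have "dead_gen z \<noteq> 0" using assms(1) by (auto simp: dead_gen_def)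
  moreover have "gen_bit (dead_gen z) (\<omega> 0)" "gen_bit (dead_gen z) (\<omega> 2)"
    using gen_bit_dead_gen[OF assms(1)] assms(3,4) by blast+
  moreover have "\<not> gen_bit (dead_gen z) (\<omega> 1)"
    using gen_bit_dead_gen[OF assms(1,1)] assms(2) by simp
  ultimately have t: "dead_gen z \<noteq> 0" "gen_bit (dead_gen z) (\<omega> 0)" "\<not> gen_bit (dead_gen z) (\<omega> (Suc 0))"
    "gen_bit (dead_gen z) (\<omega> (Suc (Suc 0)))"
    by (simp_all add: numeral_2_eq_2)
  have "ev \<omega> ([0, dead_gen z, 0, dead_gen z, 0, dead_gen z, 0, dead_gen z] @ [0, 4, 0, 4, 0, 4, 0, 4])
      [False, False, False, True] =
    ev \<omega> ([0, 4, 0, 4, 0, 4, 0, 4] @ [0, dead_gen z, 0, dead_gen z, 0, dead_gen z, 0, dead_gen z])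
      [False, False, False, True]"
    using * by (simp only: fourth_powers_commute_def append_Cons append_Nil)
  then show False using t by simp
qed

section \<open>Balls and words\<close>

abbreviation words :: "nat \<Rightarrow> (nat \<times> bool) list set" where
  "words k \<equiv> {w. fst ` set w \<subseteq> {..<k}}"

lemma
  assumes p: "marked_group k (G, S)" and w: "w \<in> words k"
  shows cayley_edge_source: "(word_value G S w, i, v) \<in> cayley_edges (G, S) \<longleftrightarrow>
      i < k \<and> v = word_value G S (w @ [(i, True)])"
    and cayley_edge_target: "(u, i, word_value G S w) \<in> cayley_edges (G, S) \<longleftrightarrow>
      i < k \<and> u = word_value G S (w @ [(i, False)])"
proof -
  interpret group G using p by (simp add: marked_group_def)
  have len: "length S = k" using p by (simp add: marked_group_def)
  have S: "S ! i \<in> carrier G" if "i < k" for i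
    using p that by (auto simp: marked_group_def)
  have wG: "word_value G S w \<in> carrier G" using word_value_closed[OF p] w by simp
  have val: "word_value G S (w @ [(i, b)]) = word_value G S w \<otimes>\<^bsub>G\<^esub> (if b then S ! i else inv\<^bsub>G\<^esub> (S ! i))"
    if "i < k" for i b
    using word_value_append[OF p, of w "[(i, b)]"] w S[OF that] that by simp
  show "(word_value G S w, i, v) \<in> cayley_edges (G, S) \<longleftrightarrow>
      i < k \<and> v = word_value G S (w @ [(i, True)])"
    using val wG len by (auto simp: cayley_edges_def)
  show "(u, i, word_value G S w) \<in> cayley_edges (G, S) \<longleftrightarrow>
      i < k \<and> u = word_value G S (w @ [(i, False)])"
  proof
    assume "(u, i, word_value G S w) \<in> cayley_edges (G, S)"
    then have u: "u \<in> carrier G" "i < k" "word_value G S w = u \<otimes>\<^bsub>G\<^esub> S ! i"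
      using len by (auto simp: cayley_edges_def)
    then show "i < k \<and> u = word_value G S (w @ [(i, False)])"
      using S by (simp add: val m_assoc)
  next
    assume i: "i < k \<and> u = word_value G S (w @ [(i, False)])"
    then have "u \<in> carrier G" "word_value G S w = u \<otimes>\<^bsub>G\<^esub> S ! i"
      using S wG by (simp_all add: val m_assoc)
    then show "(u, i, word_value G S w) \<in> cayley_edges (G, S)"
      using i len by (auto simp: cayley_edges_def)
  qed
qed

lemma ball_vertices_cayley:
  assumes p: "marked_group k (G, S)"
  shows "ball_vertices \<one>\<^bsub>G\<^esub> (cayley_edges (G, S)) n =
    word_value G S ` {w \<in> words k. length w \<le> n}"
proof (intro subset_antisym subsetI)
  fix g assume "g \<in> word_value G S ` {w \<in> words k. length w \<le> n}"
  then obtain w where w: "fst ` set w \<subseteq> {..<k}" "length w \<le> n" "g = word_value G S w" by auto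
  \<comment> \<open>Comparing the group with itself by the identity map places the value of a word
    in the ball whose radius is its length.\<close>
  have "g \<in> ball_vertices \<one>\<^bsub>G\<^esub> (cayley_edges (G, S)) (length w)"
    unfolding w(3)
    by (rule conjunct1, rule same_balls_word_value[where f = "\<lambda>g. g" and n = n, OF p p refl _ w(1,2)])
      (rule subsetD[OF ball_edges_subset])
  then show "g \<in> ball_vertices \<one>\<^bsub>G\<^esub> (cayley_edges (G, S)) n"
    by (rule subsetD[OF ball_vertices_mono[OF w(2)]])
next
  fix g assume "g \<in> ball_vertices \<one>\<^bsub>G\<^esub> (cayley_edges (G, S)) n"
  then show "g \<in> word_value G S ` {w \<in> words k. length w \<le> n}"
  proof (induction n arbitrary: g)
    case 0
    then show ?case by (auto intro!: image_eqI[of _ _ "[]"])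
  next
    case (Suc n)
    show ?case
    proof (cases "g \<in> ball_vertices \<one>\<^bsub>G\<^esub> (cayley_edges (G, S)) n")
      case True
      then have "g \<in> word_value G S ` {w \<in> words k. length w \<le> n}" by (rule Suc.IH)
      then show ?thesis by (rule subsetD[OF image_mono, rotated]) auto
    next
      case False
      then obtain u i where u: "u \<in> ball_vertices \<one>\<^bsub>G\<^esub> (cayley_edges (G, S)) n"
        "(u, i, g) \<in> cayley_edges (G, S) \<or> (g, i, u) \<in> cayley_edges (G, S)"
        using Suc.prems by auto
      obtain w where w: "w \<in> words k" "length w \<le> n" "u = word_value G S w"
        using Suc.IH[OF u(1)] by blast
      obtain b where "i < k" "g = word_value G S (w @ [(i, b)])"
        using u(2) unfolding w(3) cayley_edge_source[OF p w(1)] cayley_edge_target[OF p w(1)] by blast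
      then show ?thesis using w by (intro image_eqI[of _ _ "w @ [(i, b)]"]) auto
    qed
  qed
qed

text \<open>The index set is made of words alone and is the same for every group, so the edges of
  two balls can be matched term by term.\<close>

lemma ball_edges_cayley:
  assumes p: "marked_group k (G, S)"
  shows "ball_edges \<one>\<^bsub>G\<^esub> (cayley_edges (G, S)) n =
    (\<lambda>(u, i, v). (word_value G S u, i, word_value G S v)) `
      (\<Union>w \<in> {w \<in> words k. length w < n}. \<Union>i<k. {(w, i, w @ [(i, True)]), (w @ [(i, False)], i, w)})"
    (is "?E = ?h ` ?W")
proof (intro subset_antisym subsetI)
  fix e assume "e \<in> ?h ` ?W"
  then obtain w i where w: "w \<in> words k" "length w < n" "i < k"
    and e: "e = (word_value G S w, i, word_value G S (w @ [(i, True)])) \<or>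
      e = (word_value G S (w @ [(i, False)]), i, word_value G S w)"
    by auto
  have "word_value G S w \<in> ball_vertices \<one>\<^bsub>G\<^esub> (cayley_edges (G, S)) (length w)"
    unfolding ball_vertices_cayley[OF p] using w by blast
  moreover have "e \<in> cayley_edges (G, S)"
    using e w cayley_edge_source[OF p w(1)] cayley_edge_target[OF p w(1)] by blast
  ultimately show "e \<in> ?E"
    using e w(2) unfolding ball_edges_def by blast
next
  fix e assume e: "e \<in> ?E"
  obtain u i v where "e = (u, i, v)" by (cases e)
  with e obtain m where m: "m < n" "(u, i, v) \<in> cayley_edges (G, S)"
    "u \<in> ball_vertices \<one>\<^bsub>G\<^esub> (cayley_edges (G, S)) m \<or> v \<in> ball_vertices \<one>\<^bsub>G\<^esub> (cayley_edges (G, S)) m"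
    unfolding ball_edges_def by blast
  then obtain w where w: "w \<in> words k" "length w \<le> m" "u = word_value G S w \<or> v = word_value G S w"
    unfolding ball_vertices_cayley[OF p] by blast
  have "\<exists>x\<in>{(w, i, w @ [(i, True)]), (w @ [(i, False)], i, w)}. e = ?h x" and "i < k"
    using w(3) m(2) cayley_edge_source[OF p w(1)] cayley_edge_target[OF p w(1)] \<open>e = _\<close> by auto
  moreover have "w \<in> {w \<in> words k. length w < n}" using w m(1) by auto
  ultimately show "e \<in> ?h ` ?W" by blast
qed

text \<open>An isomorphism of balls must send the value of a word in \<open>G\<close> to its value
  in \<open>H\<close>. The condition on words says that this map is well defined and
  injective.\<close>

lemma same_cayley_balls_iff:
  assumes p: "marked_group k (G, S)" and q: "marked_group k (H, T)"
  shows "same_cayley_balls (G, S) (H, T) n \<longleftrightarrow>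
    (\<forall>v\<in>words k. \<forall>w\<in>words k. length v \<le> n \<longrightarrow> length w \<le> n \<longrightarrow>
       (word_value G S v = word_value G S w \<longleftrightarrow> word_value H T v = word_value H T w))"
    (is "?L \<longleftrightarrow> ?R")
proof
  assume ?L
  then obtain f where f: "f \<one>\<^bsub>G\<^esub> = \<one>\<^bsub>H\<^esub>"
    "bij_betw f (ball_vertices \<one>\<^bsub>G\<^esub> (cayley_edges (G, S)) n)
       (ball_vertices \<one>\<^bsub>H\<^esub> (cayley_edges (H, T)) n)"
    "(\<lambda>(u, i, v). (f u, i, f v)) ` ball_edges \<one>\<^bsub>G\<^esub> (cayley_edges (G, S)) n =
       ball_edges \<one>\<^bsub>H\<^esub> (cayley_edges (H, T)) n"
    unfolding same_cayley_balls_def same_balls_def by auto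
  have e: "(f u, i, f v) \<in> cayley_edges (H, T)"
    if "(u, i, v) \<in> ball_edges \<one>\<^bsub>G\<^esub> (cayley_edges (G, S)) n" for u i v
  proof -
    have "(f u, i, f v) \<in> ball_edges \<one>\<^bsub>H\<^esub> (cayley_edges (H, T)) n"
      unfolding f(3)[symmetric] using that by force
    then show ?thesis by (rule subsetD[OF ball_edges_subset])
  qed
  have val: "f (word_value G S w) = word_value H T w" if "w \<in> words k" "length w \<le> n" for w
    using same_balls_word_value[where f = f and n = n, OF p q f(1) e] that by blast
  have "inj_on f (word_value G S ` {w \<in> words k. length w \<le> n})"
    using f(2) unfolding ball_vertices_cayley[OF p] bij_betw_def by blast
  then show ?R
    by (smt (verit, best) val inj_onD imageI mem_Collect_eq)
next
  assume R: ?R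
  \<comment> \<open>Any short word representing \<open>g\<close> will do: by \<open>R\<close> the
    value in \<open>H\<close> does not depend on the choice.\<close>
  define word where "word g = (SOME w. (w \<in> words k \<and> length w \<le> n) \<and> word_value G S w = g)" for g
  define f where "f g = word_value H T (word g)" for g
  have f: "f (word_value G S w) = word_value H T w" if "w \<in> words k" "length w \<le> n" for w
  proof -
    have "(word (word_value G S w) \<in> words k \<and> length (word (word_value G S w)) \<le> n) \<and>
        word_value G S (word (word_value G S w)) = word_value G S w"
      unfolding word_def by (rule someI[of _ w]) (use that in blast)
    then show ?thesis using R that unfolding f_def by blast
  qed
  have "inj_on f (word_value G S ` {w \<in> words k. length w \<le> n})"
    by (rule inj_onI) (use R f in auto)
  moreover have "f ` word_value G S ` {w \<in> words k. length w \<le> n} =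
      word_value H T ` {w \<in> words k. length w \<le> n}"
    unfolding image_image by (rule image_cong) (use f in auto)
  ultimately have "bij_betw f (ball_vertices \<one>\<^bsub>G\<^esub> (cayley_edges (G, S)) n)
       (ball_vertices \<one>\<^bsub>H\<^esub> (cayley_edges (H, T)) n)"
    unfolding ball_vertices_cayley[OF p] ball_vertices_cayley[OF q] bij_betw_def by blast
  moreover have "f \<one>\<^bsub>G\<^esub> = \<one>\<^bsub>H\<^esub>" using f[of "[]"] by simp
  moreover have "(\<lambda>(u, i, v). (f u, i, f v)) ` ball_edges \<one>\<^bsub>G\<^esub> (cayley_edges (G, S)) n =
       ball_edges \<one>\<^bsub>H\<^esub> (cayley_edges (H, T)) n"
    unfolding ball_edges_cayley[OF p] ball_edges_cayley[OF q] image_image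
    by (rule image_cong) (auto simp: f)
  ultimately show ?L
    unfolding same_cayley_balls_def same_balls_def by auto
qed

section \<open>The points of the space\<close>

type_synonym aut_class = "((bool list \<Rightarrow> bool list) monoid \<times> (bool list \<Rightarrow> bool list) list) set"

abbreviation point :: "(nat \<Rightarrow> nat) \<Rightarrow> aut_class" where
  "point \<omega> \<equiv> marked_iso 8 `` {(G_tilde \<omega>, S_tilde \<omega>)}"

lemma marked_dist_point_le_iff:
  "marked_dist (point \<omega>) (point \<omega>') \<le> (1 / 2) ^ n \<longleftrightarrow>
    (\<forall>u v. set u \<subseteq> {..<8} \<longrightarrow> set v \<subseteq> {..<8} \<longrightarrow> length u \<le> n \<longrightarrow> length v \<le> n \<longrightarrow>
       (ev \<omega> u = ev \<omega> v \<longleftrightarrow> ev \<omega>' u = ev \<omega>' v))" (is "?L \<longleftrightarrow> ?R")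
proof -
  have "?L \<longleftrightarrow> (\<forall>v\<in>words 8. \<forall>w\<in>words 8. length v \<le> n \<longrightarrow> length w \<le> n \<longrightarrow>
       (ev \<omega> (map fst v) = ev \<omega> (map fst w) \<longleftrightarrow> ev \<omega>' (map fst v) = ev \<omega>' (map fst w)))"
    unfolding marked_dist_class[OF marked_group_G_tilde marked_group_G_tilde] rep_dist_le_iff
      same_cayley_balls_iff[OF marked_group_G_tilde marked_group_G_tilde]
    by (intro ball_cong refl) (auto simp: word_value_G_tilde)
  also have "\<dots> \<longleftrightarrow> ?R"
  proof
    assume words: "\<forall>v\<in>words 8. \<forall>w\<in>words 8. length v \<le> n \<longrightarrow> length w \<le> n \<longrightarrow>
       (ev \<omega> (map fst v) = ev \<omega> (map fst w) \<longleftrightarrow> ev \<omega>' (map fst v) = ev \<omega>' (map fst w))"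
    show ?R
    proof (intro allI impI)
      fix u v :: "nat list"
      assume "set u \<subseteq> {..<8}" "set v \<subseteq> {..<8}" "length u \<le> n" "length v \<le> n"
      then show "ev \<omega> u = ev \<omega> v \<longleftrightarrow> ev \<omega>' u = ev \<omega>' v"
        using words[rule_format, of "map (\<lambda>l. (l, True)) u" "map (\<lambda>l. (l, True)) v"]
        by (simp add: image_image comp_def)
    qed
  next
    assume ?R
    then show "\<forall>v\<in>words 8. \<forall>w\<in>words 8. length v \<le> n \<longrightarrow> length w \<le> n \<longrightarrow>
       (ev \<omega> (map fst v) = ev \<omega> (map fst w) \<longleftrightarrow> ev \<omega>' (map fst v) = ev \<omega>' (map fst w))"
      by (metis (no_types, lifting) length_map list.set_map mem_Collect_eq)
  qed
  finally show ?thesis .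
qed

text \<open>The factor 2 arises because comparing two words of length at most \<open>n\<close> tests
  one word of length at most \<open>2 * n\<close>.\<close>

lemma point_near:
  assumes "\<And>i. i < 2 * n \<Longrightarrow> \<omega> i = \<omega>' i" "\<omega> ` {2 * n..} = \<omega>' ` {2 * n..}"
  shows "marked_dist (point \<omega>) (point \<omega>') \<le> (1 / 2) ^ n"
  unfolding marked_dist_point_le_iff ev_eq_iff
  using ev_local[OF assms] by (metis add_mono length_append length_rev mult_2)

lemma point_eqD:
  assumes "point \<omega> = point \<omega>'" "set u \<subseteq> {..<8}" "set v \<subseteq> {..<8}" "ev \<omega> u = ev \<omega> v"
  shows "ev \<omega>' u = ev \<omega>' v"
proof -
  interpret Metric_space "marked_groups 8" marked_dist by (rule Metric_space_marked_groups)
  have "point \<omega> \<in> marked_groups 8" for \<omega>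
    using marked_group_G_tilde by (auto simp: marked_groups_def intro: quotientI)
  then have "marked_dist (point \<omega>) (point \<omega>') = 0"
    using assms(1) by simp
  then have "marked_dist (point \<omega>) (point \<omega>') \<le> (1 / 2) ^ max (length u) (length v)"
    by simp
  then show ?thesis
    using assms(2-4) unfolding marked_dist_point_le_iff by (meson max.cobounded1 max.cobounded2)
qed

text \<open>\<open>lift\<close> does not depend on the sequence, so the same two words test both
  groups, whatever the first \<open>n\<close> letters are.\<close>

lemma point_neq:
  assumes "z \<in> {0, 1, 2}" "\<omega> n = z" "\<omega>' (n + 1) = z" "\<omega>' n \<in> {0, 1, 2} - {z}" "\<omega>' (n + 2) \<in> {0, 1, 2} - {z}"
  shows "point \<omega> \<noteq> point \<omega>'"
proof
  assume eq: "point \<omega> = point \<omega>'"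
  let ?u = "(lift ^^ n) [0, dead_gen z]" and ?w = "(lift ^^ n) [0, 4]"
  have "set ((lift ^^ n) w) \<subseteq> {..<8}" if "set w \<subseteq> {..<8}" for w
    using that by (induction n) (simp_all add: lift_alphabet)
  then have uw: "set ?u \<subseteq> {..<8}" "set ?w \<subseteq> {..<8}" by (simp_all add: dead_gen_def)
  have "fourth_powers_commute (\<lambda>k. \<omega> (n + k)) [0, dead_gen z] [0, 4]"
    using assms(1,2) by (intro fourth_powers_commute_dead) auto
  then have "fourth_powers_commute \<omega> ?u ?w"
    by (simp add: fourth_powers_commute_lift_iterated)
  then have "fourth_powers_commute \<omega>' ?u ?w"
    unfolding fourth_powers_commute_def
    by (rule point_eqD[OF eq, rotated 2]) (use uw in auto)
  then show False
    using assms not_fourth_powers_commute[of z "\<lambda>k. \<omega>' (n + k)"]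
    by (simp add: fourth_powers_commute_lift_iterated)
qed

section \<open>The closure\<close>

definition not_eventually_constant :: "(nat \<Rightarrow> nat) \<Rightarrow> bool" where
  "not_eventually_constant \<omega> \<longleftrightarrow> (\<forall>n. \<exists>i\<in>\<omega> ` {n..}. \<exists>j\<in>\<omega> ` {n..}. i \<noteq> j)"

text \<open>Both sequences agree with \<open>\<omega>\<close> below \<open>2 n\<close> and have the same set of letters beyond; they differ
  only at position \<open>2 n\<close>.\<close>

lemma two_points_near:
  assumes \<omega>: "\<omega> \<in> Omega" and ij: "i \<in> \<omega> ` {2 * n..}" "j \<in> \<omega> ` {2 * n..}" "i \<noteq> j"
  obtains \<omega>\<^sub>1 \<omega>\<^sub>2 where "\<omega>\<^sub>1 \<in> Omega" "\<omega>\<^sub>2 \<in> Omega" "not_eventually_constant \<omega>\<^sub>1"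
    "not_eventually_constant \<omega>\<^sub>2" "point \<omega>\<^sub>1 \<noteq> point \<omega>\<^sub>2"
    "marked_dist (point \<omega>) (point \<omega>\<^sub>1) \<le> (1 / 2) ^ n" "marked_dist (point \<omega>) (point \<omega>\<^sub>2) \<le> (1 / 2) ^ n"
proof -
  define m where "m = 2 * n"
  \<comment> \<open>Interleaving: \<open>i\<close> and \<open>j\<close> recur forever, which
    prevents eventual constancy, and every third entry runs through the tail of
    \<open>\<omega>\<close>, so no letter of the tail is lost.\<close>
  define \<rho> where "\<rho> k = (if k mod 3 = 0 then i else if k mod 3 = 1 then j else \<omega> (m + k div 3))" for k
  define \<tau> where "\<tau> s k = (if k < m then \<omega> k else if k = m then s else \<rho> (k - Suc m))" for s k
  have \<rho>: "\<rho> (3 * k) = i" "\<rho> (3 * k + 1) = j" "\<rho> (3 * k + 2) = \<omega> (m + k)" for k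
  proof -
    have "(3 * k) mod 3 = 0" "(3 * k + 1) mod 3 = 1" "(3 * k + 2) mod 3 = 2" "(3 * k + 2) div 3 = k"
      by presburger+
    then show "\<rho> (3 * k) = i" "\<rho> (3 * k + 1) = j" "\<rho> (3 * k + 2) = \<omega> (m + k)"
      unfolding \<rho>_def by presburger+
  qed
  have letter: "\<omega> k \<in> {0, 1, 2}" for k
    using \<omega> unfolding Omega_def by blast
  have i: "i \<in> {0, 1, 2}" and j: "j \<in> {0, 1, 2}"
    using letter ij(1,2) by (metis imageE)+
  have \<rho>_\<tau>: "\<rho> k = \<tau> s (Suc (m + k))" for s k
    by (simp add: \<tau>_def)
  have range_\<rho>: "\<rho> k \<in> \<omega> ` {m..}" for k
    using ij by (simp add: \<rho>_def m_def)
  have tail: "\<tau> s ` {m..} = \<omega> ` {m..}" if s: "s \<in> {i, j}" for s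
  proof (intro subset_antisym subsetI)
    fix x assume "x \<in> \<tau> s ` {m..}"
    then obtain k where "k \<ge> m" "x = \<tau> s k" by auto
    then show "x \<in> \<omega> ` {m..}"
      using range_\<rho>[of "k - Suc m"] s ij by (auto simp: \<tau>_def m_def)
  next
    fix x assume "x \<in> \<omega> ` {m..}"
    then obtain k where k: "k \<ge> m" "x = \<omega> k" by auto
    then have "x = \<tau> s (Suc (m + (3 * (k - m) + 2)))"
      using \<rho>(3)[of "k - m"] by (simp add: \<rho>_\<tau>[of _ s])
    then show "x \<in> \<tau> s ` {m..}" by (rule image_eqI) simp
  qed
  have Omega: "\<tau> s \<in> Omega" if s: "s \<in> {i, j}" for s
  proof -
    have "\<tau> s k \<in> {0, 1, 2}" for k
    proof (cases "k < m")
      case False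
      then have "\<tau> s k \<in> \<omega> ` {m..}" using tail[OF s] by auto
      then show ?thesis using letter by (metis imageE)
    qed (use \<omega> in \<open>simp add: \<tau>_def Omega_def\<close>)
    then show ?thesis by (simp add: Omega_def)
  qed
  have nec: "not_eventually_constant (\<tau> s)" for s
    unfolding not_eventually_constant_def
  proof
    fix N
    have "i \<in> \<tau> s ` {N..}"
      using \<rho>(1)[of N] by (intro image_eqI[of _ _ "Suc (m + 3 * N)"]) (simp_all add: \<rho>_\<tau>[of _ s])
    moreover have "j \<in> \<tau> s ` {N..}"
      using \<rho>(2)[of N] by (intro image_eqI[of _ _ "Suc (m + (3 * N + 1))"]) (simp_all add: \<rho>_\<tau>[of _ s])
    ultimately show "\<exists>i\<in>\<tau> s ` {N..}. \<exists>j\<in>\<tau> s ` {N..}. i \<noteq> j" using ij(3) by blast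
  qed
  have near: "marked_dist (point \<omega>) (point (\<tau> s)) \<le> (1 / 2) ^ n" if "s \<in> {i, j}" for s
    using tail[OF that] by (intro point_near) (simp_all add: \<tau>_def m_def)
  \<comment> \<open>From position \<open>m\<close> on, \<open>\<tau> j\<close> reads
    \<open>j i j\<close> while \<open>\<tau> i\<close> begins with \<open>i\<close>: the pattern of
    \<open>point_neq\<close> with \<open>z = i\<close>.\<close>
  have "\<tau> i m = i" "\<tau> j m = j" "\<tau> j (m + 1) = i" "\<tau> j (m + 2) = j"
    using \<rho>(1,2)[of 0] by (simp_all add: \<tau>_def)
  then have "point (\<tau> i) \<noteq> point (\<tau> j)"
    using i j ij(3) by (intro point_neq[of i _ m]) auto
  then show ?thesis
    using that[of "\<tau> i" "\<tau> j"] Omega nec near by blast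
qed

text \<open>Generator number 3 is \<open>d\<close>, trivial only for the constant sequence 0; a ball
  of radius 1 shows whether a generator is trivial.\<close>

lemma point_eq_of_dist_le_half:
  assumes "marked_dist (point (\<lambda>_. 0)) (point \<omega>) \<le> 1 / 2" "\<omega> \<in> Omega"
  shows "\<omega> = (\<lambda>_. 0)"
proof -
  have d: "ev \<omega> [3] = id \<longleftrightarrow> (\<forall>n. \<not> gen_bit 3 (\<omega> n))" for \<omega>
    using ev_spine[of "[3]" \<omega>] by (simp add: spine_aut_eq_id_iff)
  have "ev \<omega> [3] = ev \<omega> [] \<longleftrightarrow> ev (\<lambda>_. 0) [3] = ev (\<lambda>_. 0) []"
    using assms(1) marked_dist_point_le_iff[of "\<lambda>_. 0" \<omega> 1] by simp
  moreover have "ev \<omega> [] = id" for \<omega> by auto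
  ultimately have "\<forall>n. \<not> gen_bit 3 (\<omega> n)"
    using d by (simp add: gen_bit_def)
  moreover have "\<omega> n \<in> {0, 1, 2}" for n using assms(2) by (simp add: Omega_def)
  ultimately show ?thesis by (auto simp: gen_bit_def)
qed

lemma (in Metric_space) openin_subtopology_singleton_iff:
  assumes "A \<subseteq> M" "p \<in> A"
  shows "openin (subtopology mtopology A) {p} \<longleftrightarrow> (\<exists>n. \<forall>q\<in>A. d p q \<le> (1 / 2) ^ n \<longrightarrow> q = p)"
proof
  assume "openin (subtopology mtopology A) {p}"
  then obtain U where U: "openin mtopology U" "{p} = U \<inter> A" by (auto simp: openin_subtopology)
  then obtain r where r: "r > 0" "mball p r \<subseteq> U" unfolding openin_mtopology by blast
  obtain n where "(1 / 2) ^ n < r" using real_arch_pow_inv[of r "1 / 2"] r(1) by auto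
  then have "\<forall>q\<in>A. d p q \<le> (1 / 2) ^ n \<longrightarrow> q = p"
    using U(2) r(2) assms by (auto simp: subset_iff)
  then show "\<exists>n. \<forall>q\<in>A. d p q \<le> (1 / 2) ^ n \<longrightarrow> q = p" ..
next
  assume "\<exists>n. \<forall>q\<in>A. d p q \<le> (1 / 2) ^ n \<longrightarrow> q = p"
  then obtain n where "\<forall>q\<in>A. d p q \<le> (1 / 2) ^ n \<longrightarrow> q = p" ..
  then have "{p} = mball p ((1 / 2) ^ n) \<inter> A"
    using assms by auto
  then show "openin (subtopology mtopology A) {p}"
    by (metis openin_mball openin_subtopology)
qed

lemma finite_eventually_constant:
  "finite {\<omega> \<in> Omega. \<forall>i\<in>\<omega> ` {m..}. \<forall>j\<in>\<omega> ` {m..}. i = j}" (is "finite ?W")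
proof (rule finite_subset)
  \<comment> \<open>Such a sequence is determined by its first \<open>m + 1\<close> letters, the
    last of which repeats forever; hence the index \<open>min k m\<close>.\<close>
  show "?W \<subseteq> (\<lambda>xs k. xs ! min k m) ` {xs. set xs \<subseteq> {0, 1, 2} \<and> length xs = Suc m}"
  proof
    fix \<omega> assume \<omega>: "\<omega> \<in> ?W"
    have "\<omega> k = map \<omega> [0..<Suc m] ! min k m" for k
    proof (cases "k \<le> m")
      case False
      then have "\<omega> k = \<omega> m" using \<omega> by auto
      then show ?thesis using False by (simp add: min_def del: upt_Suc)
    qed (simp add: min_def del: upt_Suc)
    then have "\<omega> = (\<lambda>k. map \<omega> [0..<Suc m] ! min k m)" ..
    moreover have "\<omega> k \<in> {0, 1, 2}" for k
      using \<omega> unfolding Omega_def by blast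
    then have "set (map \<omega> [0..<Suc m]) \<subseteq> {0, 1, 2}"
      unfolding set_map by (rule image_subsetI)
    moreover have "length (map \<omega> [0..<Suc m]) = Suc m"
      by simp
    ultimately show "\<omega> \<in> (\<lambda>xs k. xs ! min k m) ` {xs. set xs \<subseteq> {0, 1, 2} \<and> length xs = Suc m}"
      by blast
  qed
  show "finite ((\<lambda>xs k. xs ! min k m) ` {xs. set xs \<subseteq> {0, 1, 2::nat} \<and> length xs = Suc m})"
    by (intro finite_imageI finite_lists_length_eq) simp
qed

section \<open>Isolated and non-isolated points of the closure\<close>

interpretation M8: Metric_space "marked_groups 8 :: aut_class set" marked_dist
  by (rule Metric_space_marked_groups)

abbreviation X_closure :: "aut_class set" where
  "X_closure \<equiv> M8.mtopology closure_of X_tilde"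

lemma X_closure_subset: "X_closure \<subseteq> marked_groups 8"
  using closure_of_subset_topspace[of M8.mtopology X_tilde] by simp

lemma point_in_X_closure: "\<omega> \<in> Omega \<Longrightarrow> point \<omega> \<in> X_closure"
  using closure_of_subset[of X_tilde M8.mtopology] X_tilde_subset unfolding X_tilde_def by auto

lemma X_closure_approx:
  assumes "q \<in> X_closure" "r > 0"
  obtains \<omega> where "\<omega> \<in> Omega" "marked_dist q (point \<omega>) < r"
  using assms unfolding M8.metric_closure_of X_tilde_def M8.in_mball by blast

definition is_isolated_point :: "aut_class \<Rightarrow> aut_class set \<Rightarrow> bool" where
  "is_isolated_point p A \<longleftrightarrow> (\<exists>n. \<forall>q\<in>A. marked_dist p q \<le> (1 / 2) ^ n \<longrightarrow> q = p)"

lemma remove_isolated_X_closure: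
  assumes "A \<subseteq> X_closure"
  shows "remove_isolated (subtopology M8.mtopology X_closure) A = {p \<in> A. \<not> is_isolated_point p A}"
proof -
  have "subtopology (subtopology M8.mtopology X_closure) A = subtopology M8.mtopology A"
    using assms by (simp add: subtopology_subtopology Int_absorb1)
  moreover have "A \<subseteq> marked_groups 8" using assms X_closure_subset by blast
  ultimately have "openin (subtopology (subtopology M8.mtopology X_closure) A) {p} \<longleftrightarrow>
      is_isolated_point p A" if "p \<in> A" for p
    using M8.openin_subtopology_singleton_iff that unfolding is_isolated_point_def by simp
  then show ?thesis
    unfolding remove_isolated_def by blast
qed

text \<open>Any \<open>point \<omega>\<close> within 1/4 of a \<open>q\<close> that is itself within
  1/4 of the constant point lies within 1/2 of that point and so equals it. Thus \<open>q\<close> is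
  approximated by the constant point alone.\<close>

lemma constant_point_isolated: "is_isolated_point (point (\<lambda>_. 0)) X_closure"
  unfolding is_isolated_point_def
proof (intro exI[of _ 2] ballI impI)
  let ?p = "point (\<lambda>_. 0)"
  have p: "?p \<in> X_closure" by (rule point_in_X_closure) (simp add: Omega_def)
  fix q assume q: "q \<in> X_closure" "marked_dist ?p q \<le> (1 / 2) ^ 2"
  have "marked_dist q ?p < r" if "r > 0" for r
  proof -
    obtain \<omega> where \<omega>: "\<omega> \<in> Omega" "marked_dist q (point \<omega>) < min r (1 / 4)"
      by (rule X_closure_approx[OF q(1), of "min r (1 / 4)"]) (use \<open>r > 0\<close> in simp)
    have "marked_dist ?p (point \<omega>) \<le> marked_dist ?p q + marked_dist q (point \<omega>)"
      using p q(1) point_in_X_closure[OF \<omega>(1)] X_closure_subset by (intro M8.triangle) auto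
    then have "marked_dist ?p (point \<omega>) \<le> 1 / 2"
      using q(2) \<omega>(2) by (simp add: power2_eq_square)
    then have "\<omega> = (\<lambda>_. 0)" using point_eq_of_dist_le_half \<omega>(1) by blast
    then show ?thesis using \<omega>(2) by simp
  qed
  then have "marked_dist q ?p = 0"
    by (metis M8.nonneg less_irrefl order_le_less)
  moreover have "q \<in> marked_groups 8" "?p \<in> marked_groups 8"
    by (rule subsetD[OF X_closure_subset], fact)+
  ultimately show "q = ?p" using M8.zero by blast
qed

text \<open>Every ball contains two different points of the closure, which cannot both be its
  centre.\<close>

lemma not_isolated:
  assumes "\<omega> \<in> Omega" "not_eventually_constant \<omega>"
  shows "\<not> is_isolated_point (point \<omega>) X_closure"
proof
  assume "is_isolated_point (point \<omega>) X_closure"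
  then obtain n where n: "\<forall>q\<in>X_closure. marked_dist (point \<omega>) q \<le> (1 / 2) ^ n \<longrightarrow> q = point \<omega>"
    unfolding is_isolated_point_def by blast
  obtain i j where "i \<in> \<omega> ` {2 * n..}" "j \<in> \<omega> ` {2 * n..}" "i \<noteq> j"
    using assms(2) unfolding not_eventually_constant_def by blast
  then show False
    using two_points_near[OF assms(1)] n point_in_X_closure by metis
qed

lemma approx_nonconstant:
  assumes q: "q \<in> X_closure" "\<not> is_isolated_point q X_closure"
  obtains \<omega> i j where "\<omega> \<in> Omega" "i \<in> \<omega> ` {2 * n..}" "j \<in> \<omega> ` {2 * n..}" "i \<noteq> j"
    "marked_dist q (point \<omega>) \<le> (1 / 2) ^ n"
proof -
  have "q \<in> M8.mtopology derived_set_of X_tilde"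
    unfolding in_derived_set_of
  proof (intro conjI allI impI)
    show "q \<in> topspace M8.mtopology" using q(1) X_closure_subset by auto
    fix U assume U: "q \<in> U \<and> openin M8.mtopology U"
    then obtain r where r: "r > 0" "M8.mball q r \<subseteq> U" unfolding M8.openin_mtopology by blast
    obtain k where k: "(1 / 2) ^ k < r / 2" using real_arch_pow_inv[of "r / 2" "1 / 2"] r(1) by auto
    obtain y where y: "y \<in> X_closure" "y \<noteq> q" "marked_dist q y \<le> (1 / 2) ^ k"
      using q(2) unfolding is_isolated_point_def by blast
    have "q \<in> marked_groups 8" "y \<in> marked_groups 8"
      by (rule subsetD[OF X_closure_subset], fact)+
    then have pos: "marked_dist y q > 0"
      using M8.mdist_pos_less[OF y(2)] by blast
    \<comment> \<open>The bound \<open>marked_dist y q\<close> forces \<open>point \<omega>\<close>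
      to differ from \<open>q\<close>, making \<open>q\<close> an accumulation point of
      \<open>X_tilde\<close> itself.\<close>
    obtain \<omega> where \<omega>: "\<omega> \<in> Omega" "marked_dist y (point \<omega>) < min (r / 2) (marked_dist y q)"
      by (rule X_closure_approx[OF y(1), of "min (r / 2) (marked_dist y q)"]) (use r(1) pos in simp)
    have M: "q \<in> marked_groups 8" "y \<in> marked_groups 8" "point \<omega> \<in> marked_groups 8"
      using q(1) y(1) point_in_X_closure[OF \<omega>(1)] X_closure_subset by auto
    have "marked_dist q (point \<omega>) < r"
      using M8.triangle[OF M] y(3) k \<omega>(2) by simp
    then have "point \<omega> \<in> U" using r(2) M by auto
    moreover have "point \<omega> \<noteq> q" using \<omega>(2) by auto
    moreover have "point \<omega> \<in> X_tilde" using \<omega>(1) unfolding X_tilde_def by blast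
    ultimately show "\<exists>y. y \<noteq> q \<and> y \<in> X_tilde \<and> y \<in> U"
      by (intro exI[of _ "point \<omega>"] conjI)
  qed
  then have inf: "infinite (X_tilde \<inter> M8.mball q ((1 / 2) ^ n))"
    unfolding M8.derived_set_of_infinite_mball by simp
  let ?W = "{\<omega> \<in> Omega. \<forall>i\<in>\<omega> ` {2 * n..}. \<forall>j\<in>\<omega> ` {2 * n..}. i = j}"
  have "finite (point ` ?W)"
    by (rule finite_imageI[OF finite_eventually_constant])
  then have "\<not> X_tilde \<inter> M8.mball q ((1 / 2) ^ n) \<subseteq> point ` ?W"
    using inf finite_subset[of "X_tilde \<inter> M8.mball q ((1 / 2) ^ n)" "point ` ?W"] by blast
  then obtain p where p: "p \<in> X_tilde" "p \<in> M8.mball q ((1 / 2) ^ n)" "p \<notin> point ` ?W"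
    by (meson IntD1 IntD2 subsetI)
  obtain \<omega> where \<omega>: "p = point \<omega>" "\<omega> \<in> Omega"
    using p(1) unfolding X_tilde_def by blast
  then have "\<omega> \<notin> ?W" using p(3) by blast
  then obtain i j where "i \<in> \<omega> ` {2 * n..}" "j \<in> \<omega> ` {2 * n..}" "i \<noteq> j"
    using \<omega>(2) by blast
  moreover have "marked_dist q (point \<omega>) \<le> (1 / 2) ^ n"
    using p(2) unfolding \<omega>(1) by simp
  ultimately show ?thesis using that \<omega>(2) by blast
qed

lemma derivative_perfect:
  assumes q: "q \<in> X_closure" "\<not> is_isolated_point q X_closure"
  shows "\<not> is_isolated_point q {p \<in> X_closure. \<not> is_isolated_point p X_closure}"
proof
  assume "is_isolated_point q {p \<in> X_closure. \<not> is_isolated_point p X_closure}"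
  then obtain n where n: "p = q"
    if "p \<in> X_closure" "\<not> is_isolated_point p X_closure" "marked_dist q p \<le> (1 / 2) ^ n" for p
    unfolding is_isolated_point_def by blast
  \<comment> \<open>Exponent \<open>Suc n\<close> halves the radius, leaving room for two steps in
    the triangle inequality.\<close>
  obtain \<omega> i j where \<omega>: "\<omega> \<in> Omega" "i \<in> \<omega> ` {2 * Suc n..}" "j \<in> \<omega> ` {2 * Suc n..}" "i \<noteq> j"
    "marked_dist q (point \<omega>) \<le> (1 / 2) ^ Suc n"
    by (rule approx_nonconstant[OF q])
  have "point \<omega>' = q" if "\<omega>' \<in> Omega" "not_eventually_constant \<omega>'"
    "marked_dist (point \<omega>) (point \<omega>') \<le> (1 / 2) ^ Suc n" for \<omega>'
  proof (rule n)
    have "marked_dist q (point \<omega>') \<le> marked_dist q (point \<omega>) + marked_dist (point \<omega>) (point \<omega>')"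
      using q(1) point_in_X_closure \<omega>(1) that(1) X_closure_subset by (intro M8.triangle) auto
    then show "marked_dist q (point \<omega>') \<le> (1 / 2) ^ n"
      using \<omega>(5) that(3) by simp
  qed (use that point_in_X_closure not_isolated in auto)
  moreover obtain \<omega>\<^sub>1 \<omega>\<^sub>2 where "\<omega>\<^sub>1 \<in> Omega" "\<omega>\<^sub>2 \<in> Omega" "not_eventually_constant \<omega>\<^sub>1"
    "not_eventually_constant \<omega>\<^sub>2" "point \<omega>\<^sub>1 \<noteq> point \<omega>\<^sub>2"
    "marked_dist (point \<omega>) (point \<omega>\<^sub>1) \<le> (1 / 2) ^ Suc n"
    "marked_dist (point \<omega>) (point \<omega>\<^sub>2) \<le> (1 / 2) ^ Suc n"
    by (rule two_points_near[OF \<omega>(1-4)])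
  ultimately show False by blast
qed

theorem mainTheorem5:
  shows "is_CB_rank (subtopology (marked_topology 8) (marked_topology 8 closure_of X_tilde)) (1::nat)"
proof -
  let ?T = "subtopology M8.mtopology X_closure"
  let ?Y' = "{p \<in> X_closure. \<not> is_isolated_point p X_closure}"
  have d0: "cb_derivative ?T (0::nat) = X_closure"
    using X_closure_subset by (simp add: cb_derivative_nat(1) Int_absorb1)
  have r0: "remove_isolated ?T X_closure = ?Y'"
    by (simp add: remove_isolated_X_closure)
  have d1: "cb_derivative ?T (1::nat) = ?Y'"
    using cb_derivative_nat(2)[of ?T 0] d0 r0 by simp
  have r1: "remove_isolated ?T ?Y' = ?Y'"
    using derivative_perfect by (subst remove_isolated_X_closure) auto
  \<comment> \<open>The first derivative loses this isolated point, so the rank is not 0.\<close>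
  have "point (\<lambda>_. 0) \<in> X_closure - ?Y'"
    using constant_point_isolated point_in_X_closure[of "\<lambda>_. 0"] by (auto simp: Omega_def)
  then have ne: "?Y' \<noteq> X_closure" by blast
  show ?thesis
    unfolding is_CB_rank_def marked_topology_def
  proof (intro conjI allI impI)
    show "remove_isolated ?T (cb_derivative ?T (1::nat)) = cb_derivative ?T (1::nat)"
      unfolding d1 by (rule r1)
    fix \<beta> :: nat assume "\<beta> < 1"
    then have \<beta>: "\<beta> = 0" by simp
    show "remove_isolated ?T (cb_derivative ?T \<beta>) \<noteq> cb_derivative ?T \<beta>"
      unfolding \<beta> d0 r0 by (rule ne)
  qed
qed

end
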